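(* We have $$\{2w(2w-1)+x(2x-1)+y(2y-1)+z(2z-1):\ w,x,y,z\in\mathbb{N}\}=\mathbb{N}\setminus\{11,26,50\}.$$ Also, any integer $n\geq 90$ can be written as $2w(2w+1)+x(2x+1)+y(2y+1)+z(2z+1)$ with $w,x,y,z\in\mathbb{N}$.
   Context: $\mathbb{N}=\{0,1,2,\ldots\}$. *)

theory Defs
  imports Main
begin

end

theory Submission
  imports Defs "HOL-Number_Theory.Number_Theory" "HOL-Number_Theory.Prime_Powers"
    "HOL-Computational_Algebra.Squarefree"
begin

text \<open>With \<open>a = x\<^sup>2 + y\<^sup>2 + z\<^sup>2 + 2w\<^sup>2\<close> and \<open>b = x + y + z + 2w\<close> the two sums are \<open>2a - b\<close> and
  \<open>2a + b\<close>. As in Cauchy's treatment of polygonal numbers, \<open>4a < b\<^sup>2 + 2b + 5\<close> forces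
  \<open>x, y, z, w \<ge> 0\<close>, and in terms of \<open>(p, q, r) = (x - w, y - w, z - w)\<close> solving for given \<open>a\<close>, \<open>b\<close> means
  representing \<open>(5a - b\<^sup>2)/2\<close> by \<open>2(p\<^sup>2 + q\<^sup>2 + r\<^sup>2) - pq - qr - rp\<close>. This form represents every integer it
  represents rationally, since its covering radius is less than 1, and over the rationals its double
  is \<open>A\<^sup>2 + 5B\<^sup>2 + 10C\<^sup>2\<close>. If \<open>5\<close> does not divide \<open>b\<close>, a rational representation of the squarefree part
  \<open>K\<close> of \<open>5a - b\<^sup>2\<close> is found from a prime \<open>m \<equiv> 3 (mod 8)\<close> with \<open>(m/q) = (-5/q)\<close> for the odd primes
  \<open>q | K\<close>: the conics \<open>K t\<^sup>2 = A\<^sup>2 + 5m E\<^sup>2\<close> and \<open>m t\<^sup>2 = B\<^sup>2 + 2C\<^sup>2\<close> are both solvable by quadratic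
  reciprocity. The existence of \<open>m\<close> is Dirichlet's theorem for conditions on quadratic characters
  only, for which real-valued L-series suffice. The remaining small numbers are checked directly.\<close>

section \<open>Real characters and their L-series\<close>

text \<open>The prime \<open>m\<close> is a value shared by two binary forms: multiplying the first
  conic by the square from the second turns \<open>5 m E^2\<close> into
  \<open>5 (E B)^2 + 10 (E C)^2\<close>, which splits the ternary problem into two binary ones. What
  shapes the choice of \<open>m\<close> is the condition (K/m) = 1 of the first conic, where K is
  known only by its class modulo 5. If m = 3 (mod 8), reciprocity turns (m/q) = (-5/q) into (q/m) =
  (q/5) for the odd primes q | K, and (2/m) = (2/5) = -1, so (K/m) = (K/5); the same congruence
  makes -2 a residue modulo m, as the second conic demands. Finally (K/5) = 1 because 5a - b^2 =
  -b^2 (mod 5), which is why 5 must not divide b. For n = 2a - b or 2a + b, the parity of a + b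
  fixes b modulo 4, and the two inequalities b^2 < 5a and 4a < b^2 + 2b + 5 confine b to lie roughly
  between sqrt(2n) and sqrt(5n/2). A b prime to 5 is certain once eight consecutive integers fit
  there, which decides how many numbers are left to direct checking.\<close>

lemma sum_mult_antimono_bound:
  fixes a f :: "nat \<Rightarrow> real"
  assumes sums: "\<And>n. \<bar>\<Sum>k=m..n. a k\<bar> \<le> C"
    and anti: "\<And>n. n \<ge> m \<Longrightarrow> f (Suc n) \<le> f n"
    and nonneg: "\<And>n. n \<ge> m \<Longrightarrow> 0 \<le> f n"
  shows "\<bar>\<Sum>k=m..n. a k * f k\<bar> \<le> C * f m"
proof (cases "m \<le> n")
  case False
  have "0 \<le> C" using sums[of 0] by linarith
  with False nonneg[of m] show ?thesis by simp
next
  case True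
  \<comment> \<open>Abel summation arranged for induction: passing from \<open>n\<close> to
    \<open>Suc n\<close> adds a partial sum of \<open>a\<close> times the drop of \<open>f\<close>,
    and the drops telescope.\<close>
  have "\<bar>(\<Sum>k=m..n. a k * f k) - (\<Sum>k=m..n. a k) * f n\<bar> \<le> C * (f m - f n)"
    using True
  proof (induction n rule: dec_induct)
    case base
    show ?case by simp
  next
    case (step n)
    let ?S = "\<Sum>k=m..n. a k * f k" and ?A = "\<Sum>k=m..n. a k"
    have "(\<Sum>k=m..Suc n. a k * f k) - (\<Sum>k=m..Suc n. a k) * f (Suc n)
        = (?S - ?A * f n) + ?A * (f n - f (Suc n))"
      using step.hyps by (simp add: algebra_simps)
    moreover have "\<bar>?A * (f n - f (Suc n))\<bar> \<le> C * (f n - f (Suc n))"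
      using anti[of n] step.hyps sums[of n] by (simp add: abs_mult mult_right_mono)
    ultimately show ?case using step.IH by (simp add: algebra_simps)
  qed
  moreover have "\<bar>(\<Sum>k=m..n. a k) * f n\<bar> \<le> C * f n"
    using nonneg[of n] True sums[of n] by (simp add: abs_mult mult_right_mono)
  ultimately show ?thesis by (simp add: algebra_simps)
qed

text \<open>Divided by \<open>s * (1 - s^2)\<close> this is the AM-GM bound n s^(n-1) \<le> 1 + s^2
  + ... + s^(2n-2). It is applied with t = s^2, so that the geometric mean is an integral power of
  s.\<close>

lemma one_minus_power_ge:
  fixes s :: real
  assumes "0 < s" "s < 1"
  shows "real n * (1 - s^2) * s ^ n \<le> s * (1 - s ^ (2 * n))"
proof (induction n)
  case 0
  show ?case by simp
next
  case (Suc n)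
  have "0 \<le> (1 - s ^ n) * (1 - s ^ Suc n)"
    using assms by (intro mult_nonneg_nonneg) (auto intro!: power_le_one simp del: power_Suc)
  then have "s ^ n + s ^ Suc n \<le> 1 + s ^ (2 * n + 1)"
    by (simp add: algebra_simps flip: power_add mult_2)
  then have "(1 - s) * (s ^ n + s ^ Suc n) \<le> (1 - s) * (1 + s ^ (2 * n + 1))"
    using assms by (intro mult_left_mono) auto
  then have "real n * (1 - s^2) * s ^ n + (1 - s) * (s ^ n + s ^ Suc n) 
     \<le> s * (1 - s ^ (2 * n)) + (1 - s) * (1 + s ^ (2 * n + 1))"
    using Suc by linarith
  then have "s * (real n * (1 - s^2) * s ^ n + (1 - s) * (s ^ n + s ^ Suc n))
     \<le> s * (s * (1 - s ^ (2 * n)) + (1 - s) * (1 + s ^ (2 * n + 1)))"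
    using assms by (intro mult_left_mono) auto
  then show ?case by (simp add: algebra_simps power2_eq_square)
qed

text \<open>Monsky's proof of \<open>L(1, \<chi>) \<noteq> 0\<close>: the Lambert series \<open>\<Sum> \<chi>(n) t^n / (1 - t^n)\<close> tends to
  infinity as \<open>t\<close> tends to 1, because its power series coefficients \<open>\<Sum>\<^bsub>d | m\<^esub> \<chi>(d)\<close> are nonnegative and at
  least 1 at squares. If \<open>L(1, \<chi>)\<close> vanished, the terms \<open>\<chi>(n) / (n (1 - t))\<close> could be subtracted
  for free, and the remaining coefficients of \<open>\<chi>(n)\<close> are monotone in \<open>n\<close>, so that the series would stay
  bounded.\<close>

definition lambert_gap :: "real \<Rightarrow> nat \<Rightarrow> real" where
  "lambert_gap t n = 1 / (real n * (1 - t)) - t ^ n / (1 - t ^ n)"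

lemma lambert_gap_nonneg:
  assumes "0 < t" "t < 1" "n \<ge> 1"
  shows "0 \<le> lambert_gap t n"
proof -
  obtain s where s: "0 < s" "s < 1" "t = s^2"
    using assms by (metis real_sqrt_gt_zero real_sqrt_lt_1_iff real_sqrt_pow2 less_imp_le)
  have tn: "t ^ n = s ^ (2 * n)" by (simp add: s(3) power_mult)
  have "s ^ (2 * n) * s \<le> s ^ n"
  proof -
    have "s ^ (2 * n + 1) \<le> s ^ n" using s by (intro power_decreasing) auto
    then show ?thesis by (simp add: mult.commute)
  qed
  then have "real n * (1 - s^2) * (s ^ (2 * n) * s) \<le> real n * (1 - s^2) * s ^ n"
    using s by (intro mult_left_mono mult_nonneg_nonneg) (auto simp: power_le_one)
  also have "\<dots> \<le> s * (1 - s ^ (2 * n))" by (rule one_minus_power_ge[OF s(1,2)])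
  finally have "s * (real n * (1 - t) * t ^ n) \<le> s * (1 - t ^ n)"
    unfolding tn unfolding s(3) by (simp only: mult_ac)
  then have "real n * (1 - t) * t ^ n \<le> 1 - t ^ n" using s(1) by (rule mult_left_le_imp_le)
  then have "t ^ n * (real n * (1 - t)) \<le> 1 * (1 - t ^ n)" by (simp add: mult_ac)
  moreover have "t ^ n < 1" using assms by (simp add: power_less_one_iff)
  ultimately have "t ^ n / (1 - t ^ n) \<le> 1 / (real n * (1 - t))"
    using assms by (intro frac_le_eq[THEN iffD2]) (auto simp: divide_simps) 
  then show ?thesis by (simp add: lambert_gap_def)
qed

text \<open>The claim amounts to n (n+1) (1-t)^2 t^n \<le> P, and multiplying the AM-GM bounds for n
  and n+1 gives this with a factor s < 1 to spare.\<close>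

lemma lambert_gap_antimono:
  assumes "0 < t" "t < 1" "n \<ge> 1"
  shows "lambert_gap t (Suc n) \<le> lambert_gap t n"
proof -
  obtain s where s: "0 < s" "s < 1" "t = s^2"
    using assms by (metis real_sqrt_gt_zero real_sqrt_lt_1_iff real_sqrt_pow2 less_imp_le)
  have t1: "t ^ n < 1" "t ^ Suc n < 1"
    using assms power_less_one_iff[of t n] power_less_one_iff[of t "Suc n"] by auto
  define P where "P = (1 - t ^ n) * (1 - t ^ Suc n)"
  have P: "0 < P" using t1 by (simp add: P_def)
  have "(real n * (1 - s^2) * s ^ n) * (real (Suc n) * (1 - s^2) * s ^ Suc n)
     \<le> (s * (1 - s ^ (2 * n))) * (s * (1 - s ^ (2 * Suc n)))"
    using s by (intro mult_mono one_minus_power_ge mult_nonneg_nonneg) (auto simp: power_le_one)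
  also have "\<dots> = s^2 * P" by (simp add: P_def s(3) power2_eq_square power_mult_distrib flip: mult_2 power_mult power_add)
  finally have "s * (real n * real (Suc n) * (1 - t)^2 * t ^ n) \<le> s * (s * P)"
    by (simp add: s(3) power2_eq_square algebra_simps power_mult_distrib flip: power_add)
  then have "real n * real (Suc n) * (1 - t)^2 * t ^ n \<le> s * P" using s by simp
  also have "\<dots> \<le> P" using s P by simp
  finally have main: "real n * real (Suc n) * (1 - t)^2 * t ^ n \<le> P" .
  have "t ^ n / (1 - t ^ n) - t ^ Suc n / (1 - t ^ Suc n) = t ^ n * (1 - t) / P"
    using t1 by (simp add: P_def field_simps)
  also have "\<dots> \<le> 1 / (real n * real (Suc n) * (1 - t))"
  proof -
    define c where "c = real n * real (Suc n) * (1 - t)"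
    have "0 < c" using assms by (simp add: c_def)
    moreover have "t ^ n * (1 - t) * c \<le> P"
      using main by (simp add: c_def power2_eq_square mult_ac)
    ultimately have "t ^ n * (1 - t) / P \<le> 1 / c" using P by (simp add: field_simps)
    then show ?thesis by (simp only: c_def)
  qed
  also have "\<dots> = 1 / (real n * (1 - t)) - 1 / (real (Suc n) * (1 - t))"
    using assms by (simp add: divide_simps)
  finally show ?thesis by (simp add: lambert_gap_def)
qed

text \<open>Expands the n-th Lambert term, so that summing over n collects at t^m the values at the
  divisors of m. The index 0, a multiple of every n, has to be left out.\<close>

lemma sums_power_multiples:
  fixes t :: real
  assumes "0 < t" "t < 1" "n \<ge> 1"
  shows "(\<lambda>m. if n dvd m \<and> m \<noteq> 0 then t ^ m else 0) sums (t ^ n / (1 - t ^ n))"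
proof -
  have "t ^ n < 1" using assms by (simp add: power_less_one_iff)
  then have "(\<lambda>k. t ^ n * (t ^ n) ^ k) sums (t ^ n * (1 / (1 - t ^ n)))"
    using assms by (intro sums_mult geometric_sums) auto
  then have "(\<lambda>k. t ^ (n * Suc k)) sums (t ^ n / (1 - t ^ n))"
    by (simp add: power_mult power_add)
  moreover have "strict_mono (\<lambda>k. n * Suc k)"
    using assms by (intro strict_monoI) simp
  moreover have "m \<in> range (\<lambda>k. n * Suc k) \<longleftrightarrow> n dvd m \<and> m \<noteq> 0" for m
  proof
    assume "n dvd m \<and> m \<noteq> 0"
    then obtain k where "m = n * k" "k \<noteq> 0" by (auto elim: dvdE)
    then show "m \<in> range (\<lambda>k. n * Suc k)" by (cases k) auto
  qed (use assms in auto)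
  ultimately show ?thesis using assms(3)
    by (subst sums_mono_reindex[of "\<lambda>k. n * Suc k", symmetric]) auto
qed

lemma sum_divisors_prime_power_mult:
  fixes f :: "nat \<Rightarrow> real"
  assumes mult: "\<And>a b. f (a * b) = f a * f b" and "f 1 = 1"
    and p: "prime p" "\<not> p dvd m" and "m \<noteq> 0"
  shows "(\<Sum>d | d dvd p ^ k * m. f d) = (\<Sum>i\<le>k. f p ^ i) * (\<Sum>d | d dvd m. f d)"
proof -
  have f_pow: "f (p ^ i) = f p ^ i" for i
    by (induction i) (use assms in auto)
  have "inj_on (\<lambda>(i, d). p ^ i * d) ({..k} \<times> {d. d dvd m})"
  proof (rule inj_onI, clarsimp)
    fix i d j e assume *: "d dvd m" "e dvd m" "p ^ i * d = p ^ j * e"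
    then have nd: "\<not> p dvd d" "\<not> p dvd e" using p dvd_trans by blast+
    have "multiplicity p (p ^ i * d) = i" "multiplicity p (p ^ j * e) = j"
      using nd p by (auto intro!: multiplicity_eqI simp: prime_gt_0_nat)
    with * p show "i = j \<and> d = e" by (auto simp: prime_gt_0_nat)
  qed
  moreover have "(\<lambda>(i, d). p ^ i * d) ` ({..k} \<times> {d. d dvd m}) = {d. d dvd p ^ k * m}"
  proof (intro equalityI subsetI)
    fix x assume "x \<in> {d. d dvd p ^ k * m}"
    then obtain a b where "x = a * b" "a dvd p ^ k" "b dvd m"
      by (auto elim: division_decomp[THEN exE])
    moreover from this obtain i where "i \<le> k" "a = p ^ i"
      using divides_primepow_nat[OF p(1)] by blast
    ultimately show "x \<in> (\<lambda>(i, d). p ^ i * d) ` ({..k} \<times> {d. d dvd m})" by force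
  qed (auto intro!: mult_dvd_mono le_imp_power_dvd)
  ultimately have "(\<Sum>d | d dvd p ^ k * m. f d) = (\<Sum>(i, d) \<in> {..k} \<times> {d. d dvd m}. f (p ^ i * d))"
    using sum.reindex[of "\<lambda>(i, d). p ^ i * d" "{..k} \<times> {d. d dvd m}" f]
    by (simp add: case_prod_unfold comp_def)
  also have "\<dots> = (\<Sum>i\<le>k. f p ^ i) * (\<Sum>d | d dvd m. f d)"
    by (simp add: mult f_pow sum_product sum.cartesian_product)
  finally show ?thesis .
qed

section \<open>Chebyshev and Mertens estimates for the von Mangoldt function\<close>

lemma sum_sum_divisors:
  fixes f :: "nat \<Rightarrow> nat \<Rightarrow> real"
  shows "(\<Sum>k=1..n. \<Sum>d | d dvd k. f d k) = (\<Sum>d=1..n. \<Sum>j=1..n div d. f d (d * j))"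
proof -
  have "(\<Sum>k=1..n. \<Sum>d | d dvd k. f d k) = (\<Sum>k=1..n. \<Sum>d=1..n. if d dvd k then f d k else 0)"
  proof (rule sum.cong[OF refl])
    fix k assume k: "k \<in> {1..n}"
    then have "1 \<le> d \<and> d \<le> n" if "d dvd k" for d
      using that dvd_imp_le[of d k] dvd_pos_nat[of k d] by auto
    then show "(\<Sum>d | d dvd k. f d k) = (\<Sum>d=1..n. if d dvd k then f d k else 0)"
      by (intro sum.mono_neutral_cong_left) auto
  qed
  also have "\<dots> = (\<Sum>d=1..n. \<Sum>k=1..n. if d dvd k then f d k else 0)" by (rule sum.swap)
  also have "\<dots> = (\<Sum>d=1..n. \<Sum>j=1..n div d. f d (d * j))"
  proof (rule sum.cong[OF refl])
    fix d assume d: "d \<in> {1..n}"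
    have "(\<Sum>k=1..n. if d dvd k then f d k else 0) = (\<Sum>k | k \<in> {1..n} \<and> d dvd k. f d k)"
      by (simp add: sum.If_cases Int_def)
    also have "\<dots> = (\<Sum>j=1..n div d. f d (d * j))"
      using d by (intro sum.reindex_bij_witness[of _ "\<lambda>j. d * j" "\<lambda>k. k div d"])
        (auto simp: less_eq_div_iff_mult_less_eq mult.commute[of d] Suc_le_eq div_le_mono
          div_greater_zero_iff dvd_imp_le)
    finally show "(\<Sum>k=1..n. if d dvd k then f d k else 0) = (\<Sum>j=1..n div d. f d (d * j))" .
  qed
  finally show ?thesis .
qed

lemma ln_fact_eq_sum_mangoldt:
  "ln (fact n :: real) = (\<Sum>d=1..n. mangoldt d * real (n div d))"
proof -
  have "ln (fact n :: real) = (\<Sum>k=1..n. ln (real k))"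
    unfolding fact_prod of_nat_prod by (subst ln_prod) auto
  also have "\<dots> = (\<Sum>k=1..n. \<Sum>d | d dvd k. mangoldt d)"
    by (intro sum.cong refl) (simp add: mangoldt_sum)
  also have "\<dots> = (\<Sum>d=1..n. mangoldt d * real (n div d))"
    by (subst sum_sum_divisors) (simp add: mult.commute)
  finally show ?thesis .
qed

lemma ln_fact_ge: "real n * ln (real n) - real n \<le> ln (fact n)"
proof (induction n)
  case 0
  show ?case by simp
next
  case (Suc n)
  show ?case
  proof (cases "n = 0")
    case False
    have "ln (real (Suc n)) - ln (real n) = ln (1 + 1 / real n)"
      using False ln_div[of "real (Suc n)" "real n"] by (simp add: add_divide_distrib add.commute)
    also have "\<dots> \<le> 1 / real n" using False by (intro ln_add_one_self_le_self) auto
    finally have "real n * (ln (real (Suc n)) - ln (real n)) \<le> real n * (1 / real n)"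
      by (intro mult_left_mono) auto
    moreover have "ln (fact (Suc n) :: real) = ln (real (Suc n)) + ln (fact n)"
      by (simp only: fact_Suc of_nat_mult ln_mult of_nat_fact) (simp add: ln_mult)
    ultimately show ?thesis using Suc False by (simp add: algebra_simps)
  qed simp
qed

text \<open>Chebyshev's argument with n!/(m!)^2 for m = n div 2: the coefficient n div d - 2 (m div
  d) is never negative and is at least 1 for m < d \<le> n, so this range contributes at most
  ln(n!/(m!)^2) \<le> 2n. The induction hypothesis adds 4m \<le> 2n.\<close>

lemma sum_mangoldt_le: "(\<Sum>d=1..n. mangoldt d :: real) \<le> 4 * real n"
proof (induction n rule: less_induct)
  case (less n)
  show ?case
  proof (cases "n = 0")
    case False
    define m where "m = n div 2"
    have "(\<Sum>d\<in>{m<..n}. mangoldt d :: real) \<le> (\<Sum>d=1..n. mangoldt d * (real (n div d) - 2 * real (m div d)))"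
    proof (rule order_trans[OF _ sum_mono2[where A = "{m<..n}"]])
      show "(\<Sum>d\<in>{m<..n}. mangoldt d :: real)
          \<le> (\<Sum>d\<in>{m<..n}. mangoldt d * (real (n div d) - 2 * real (m div d)))"
      proof (rule sum_mono)
        fix d assume d: "d \<in> {m<..n}"
        then have "m div d = 0" "n div d \<ge> 1" by (auto simp: Suc_le_eq div_greater_zero_iff)
        then show "(mangoldt d :: real) \<le> mangoldt d * (real (n div d) - 2 * real (m div d))"
          using mult_left_mono[OF _ mangoldt_nonneg[of d], of 1 "real (n div d)"] by simp
      qed
      fix d assume "d \<in> {1..n} - {m<..n}"
      have "2 * (m div d) \<le> n div d"
      proof (cases "d = 0")
        case False
        have "2 * (m div d) * d \<le> 2 * m" by simp
        also have "\<dots> \<le> n" by (simp add: m_def)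
        finally show ?thesis using False by (simp add: less_eq_div_iff_mult_less_eq)
      qed simp
      then have "2 * real (m div d) \<le> real (n div d)" by linarith
      then show "(0::real) \<le> mangoldt d * (real (n div d) - 2 * real (m div d))"
        by (simp add: mangoldt_nonneg)
    qed auto
    also have "\<dots> = ln (fact n) - 2 * (\<Sum>d=1..n. mangoldt d * real (m div d))"
      unfolding ln_fact_eq_sum_mangoldt by (simp add: sum_distrib_left sum_subtractf algebra_simps)
    also have "(\<Sum>d=1..n. mangoldt d * real (m div d)) = ln (fact m)"
      unfolding ln_fact_eq_sum_mangoldt by (intro sum.mono_neutral_right) (auto simp: m_def)
    also have "ln (fact n :: real) - 2 * ln (fact m) \<le> 2 * real n"
    proof -
      \<comment> \<open>The quotient n!/(m!)^2 is \<open>n choose m\<close> for even n and m + 1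
        times that for odd n. The factor n covers both and costs only ln n \<le> n - 1.\<close>
      have "(fact n :: real) \<le> real n * 2 ^ n * (fact m)\<^sup>2"
      proof -
        have "fact (n - m) \<le> (fact m * real n)"
        proof (cases "even n")
          case True
          then have "n - m = m" by (auto simp: m_def)
          then show ?thesis using \<open>n \<noteq> 0\<close> by simp
        next
          case odd: False
          then have "n - m = Suc m" by (auto simp: m_def elim!: oddE)
          moreover have "Suc m \<le> n" using odd by (auto simp: m_def elim!: oddE)
          then have "real (Suc m) \<le> real n" by (simp only: of_nat_le_iff)
          ultimately show ?thesis by (simp add: mult.commute[of "fact m"] mult_right_mono)
        qed
        moreover have "real (n choose m) \<le> 2 ^ n"
          using binomial_le_pow2[of n m] by (metis of_nat_le_iff of_nat_numeral of_nat_power)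
        ultimately have "fact m * fact (n - m) * real (n choose m) \<le> fact m * (fact m * real n) * 2 ^ n"
          by (intro mult_mono) auto
        moreover have "fact m * fact (n - m) * real (n choose m) = fact n"
          using binomial_fact_lemma[of m n] by (metis m_def div_le_dividend of_nat_fact of_nat_mult)
        ultimately have "fact n \<le> fact m * (fact m * real n) * 2 ^ n" by (simp only:)
        then show ?thesis by (simp only: power2_eq_square mult_ac)
      qed
      then have "ln (fact n :: real) \<le> ln (real n * 2 ^ n * (fact m)\<^sup>2)"
        using False by simp
      also have "\<dots> = ln (real n) + real n * ln 2 + 2 * ln (fact m)"
        using False by (simp add: ln_mult ln_realpow)
      also have "\<dots> \<le> (real n - 1) + real n * 1 + 2 * ln (fact m)"
        using False ln_le_minus_one[of "real n"] ln_2_less_1 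
        by (intro add_mono mult_left_mono) auto
      finally show ?thesis by simp
    qed
    finally have "(\<Sum>d\<in>{m<..n}. mangoldt d :: real) \<le> 2 * real n" .
    moreover have "(\<Sum>d=1..m. mangoldt d :: real) \<le> 4 * real m"
      using False by (intro less.IH) (auto simp: m_def)
    moreover have "{1..n} = {1..m} \<union> {m<..n}" by (auto simp: m_def)
    then have "(\<Sum>d=1..n. mangoldt d :: real) = (\<Sum>d=1..m. mangoldt d) + (\<Sum>d\<in>{m<..n}. mangoldt d)"
      by (simp add: sum.union_disjoint ivl_disj_int)
    moreover have "2 * real m \<le> real n" by (simp add: m_def)
    ultimately show ?thesis by linarith
  qed simp
qed

text \<open>The half of Mertens' estimate that supplies the divergence: \<open>n div d\<close> is
  enlarged to n/d in the formula for \<open>ln (fact n)\<close>.\<close>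

lemma sum_mangoldt_over_ge:
  assumes "n \<ge> 1"
  shows "ln (real n) - 1 \<le> (\<Sum>d=1..n. mangoldt d / real d)"
proof -
  have "ln (fact n :: real) \<le> (\<Sum>d=1..n. mangoldt d * (real n / real d))"
    unfolding ln_fact_eq_sum_mangoldt
    by (intro sum_mono mult_left_mono mangoldt_nonneg of_nat_div_le_of_nat)
  also have "\<dots> = real n * (\<Sum>d=1..n. mangoldt d / real d)"
    by (simp add: sum_distrib_left mult_ac)
  finally have "real n * (ln (real n) - 1) \<le> real n * (\<Sum>d=1..n. mangoldt d / real d)"
    using ln_fact_ge[of n] by (simp add: algebra_simps)
  then show ?thesis using assms by simp
qed

text \<open>The prime powers concerned are powers of prime factors p of M, and the sum of p^(-k)
  over k \<ge> 1 is at most 1. As the bound is independent of n, the divergence survives restriction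
  to d coprime to M.\<close>

lemma sum_mangoldt_not_coprime_le:
  assumes "M \<noteq> 0"
  shows "(\<Sum>d | d \<in> {1..n} \<and> \<not> coprime d M. mangoldt d / real d) \<le> (\<Sum>p\<in>prime_factors M. ln (real p))"
proof -
  let ?h = "\<lambda>(p, k). p ^ k :: nat" and ?I = "prime_factors M \<times> {1..n}"
  have "(\<Sum>d | d \<in> {1..n} \<and> \<not> coprime d M. mangoldt d / real d) \<le> (\<Sum>d\<in>?h ` ?I. mangoldt d / real d :: real)"
  proof -
    have "(\<Sum>d | d \<in> {1..n} \<and> \<not> coprime d M. mangoldt d / real d :: real)
       = (\<Sum>d | d \<in> {1..n} \<and> \<not> coprime d M \<and> primepow d. mangoldt d / real d)"
      by (intro sum.mono_neutral_right) (auto simp: mangoldt_def)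
    also have "\<dots> \<le> (\<Sum>d\<in>?h ` ?I. mangoldt d / real d)"
    proof (intro sum_mono2)
      show "{d. d \<in> {1..n} \<and> \<not> coprime d M \<and> primepow d} \<subseteq> ?h ` ?I"
      proof
        fix d assume "d \<in> {d. d \<in> {1..n} \<and> \<not> coprime d M \<and> primepow d}"
        then have d: "d \<le> n" "\<not> coprime d M" "primepow d" by auto
        then obtain p k where pk: "prime p" "k > 0" "d = p ^ k" by (auto simp: primepow_def)
        then have "p dvd M" using d prime_imp_coprime[of p M] by auto
        moreover have "k < p ^ k"
          using less_le_trans[OF less_exp power_mono] prime_ge_2_nat[OF pk(1)] by blast
        ultimately show "d \<in> ?h ` ?I"
          using pk d assms by (intro image_eqI[of _ _ "(p, k)"]) (auto simp: prime_factors_dvd)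
      qed
    qed (auto simp: mangoldt_nonneg)
    finally show ?thesis .
  qed
  also have "\<dots> \<le> (\<Sum>(p, k)\<in>?I. mangoldt (p ^ k) / real (p ^ k))"
    using sum_image_le[of ?I "\<lambda>d. mangoldt d / real d" ?h] 
    by (simp add: mangoldt_nonneg case_prod_unfold comp_def)
  also have "\<dots> = (\<Sum>p\<in>prime_factors M. ln (real p) * (\<Sum>k=1..n. (1 / real p) ^ k))"
    by (subst sum.cartesian_product[symmetric]) 
       (auto intro!: sum.cong simp: sum_distrib_left power_divide mangoldt_primepow in_prime_factors_imp_prime)
  also have "\<dots> \<le> (\<Sum>p\<in>prime_factors M. ln (real p) * 1)"
  proof (intro sum_mono mult_left_mono)
    fix p assume "p \<in> prime_factors M"
    then have p: "p \<ge> 2" using prime_ge_2_nat in_prime_factors_imp_prime by blast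
    have "(\<Sum>k=1..n. (1 / real p) ^ k) \<le> (\<Sum>k=1..n. (1 / 2) ^ k)"
      using p by (intro sum_mono power_mono) (auto simp: field_simps)
    also have "\<dots> = 1 - (1 / 2) ^ n" by (induction n) (auto simp: field_simps)
    finally show "(\<Sum>k=1..n. (1 / real p) ^ k) \<le> 1" by (smt (verit) zero_le_power divide_nonneg_nonneg)
    show "0 \<le> ln (real p)" using p by simp
  qed
  finally show ?thesis by simp
qed

section \<open>Non-vanishing of L(1, chi) and twisted von Mangoldt sums\<close>

locale real_character =
  fixes \<chi> :: "nat \<Rightarrow> real" and C :: real
  assumes mult: "\<chi> (a * b) = \<chi> a * \<chi> b"
    and one: "\<chi> 1 = 1"
    and val: "\<chi> n \<in> {-1, 0, 1}"
    and sum_bounded: "\<bar>\<Sum>k=m..n. \<chi> k\<bar> \<le> C"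
begin

lemma abs_le_1: "\<bar>\<chi> n\<bar> \<le> 1"
  using val[of n] by auto

lemma C_nonneg: "0 \<le> C"
  using sum_bounded[of 0 0] by linarith

text \<open>These geometric sums are the Euler factors of the divisor sum of \<chi>; the two bounds
  yield the two lemmas that follow by stripping off one full prime power at a time.\<close>

lemma sum_powers: "0 \<le> (\<Sum>i\<le>k. \<chi> p ^ i)" "even k \<Longrightarrow> 1 \<le> (\<Sum>i\<le>k. \<chi> p ^ i)"
proof -
  have "(\<Sum>i\<le>k. (-1::real) ^ i) = (if even k then 1 else 0)" by (induction k) auto
  moreover have "(\<Sum>i\<le>k. (0::real) ^ i) = 1" by (induction k) auto
  ultimately show "0 \<le> (\<Sum>i\<le>k. \<chi> p ^ i)" "even k \<Longrightarrow> 1 \<le> (\<Sum>i\<le>k. \<chi> p ^ i)"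
    using val[of p] by auto
qed

lemma sum_divisors_nonneg: "n \<noteq> 0 \<Longrightarrow> 0 \<le> (\<Sum>d | d dvd n. \<chi> d)"
proof (induction n rule: less_induct)
  case (less n)
  show ?case
  proof (cases "n = 1")
    case True
    then show ?thesis using one by simp
  next
    case False
    then obtain p where p: "prime p" "p dvd n" using prime_factor_nat by blast
    from less.prems p(1) obtain m where m: "n = p ^ multiplicity p n * m" "\<not> p dvd m"
      by (metis multiplicity_decompose' not_prime_unit)
    have "m \<noteq> 0" using m less.prems by (intro notI) auto
    moreover have "multiplicity p n > 0" using p less.prems
      by (simp add: prime_multiplicity_gt_zero_iff)
    then have "p ^ multiplicity p n > 1" using p(1) prime_gt_1_nat by (intro one_less_power) auto
    then have "m < n" using \<open>m \<noteq> 0\<close> m(1) by (metis mult_less_cancel2 mult_1 neq0_conv)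
    ultimately show ?thesis
      using less.IH[of m] sum_powers(1) 
      by (subst m(1), subst sum_divisors_prime_power_mult[OF mult one p(1) m(2)]) auto
  qed
qed

lemma sum_divisors_square: "n \<noteq> 0 \<Longrightarrow> 1 \<le> (\<Sum>d | d dvd n ^ 2. \<chi> d)"
proof (induction n rule: less_induct)
  case (less n)
  show ?case
  proof (cases "n = 1")
    case True
    then show ?thesis using one by simp
  next
    case False
    then obtain p where p: "prime p" "p dvd n" using prime_factor_nat by blast
    define k where "k = multiplicity p n"
    from less.prems p(1) obtain m where m: "n = p ^ k * m" "\<not> p dvd m"
      unfolding k_def by (metis multiplicity_decompose' not_prime_unit)
    have "m \<noteq> 0" using m less.prems by (intro notI) auto
    moreover have "k > 0" using p less.prems
      by (simp add: k_def prime_multiplicity_gt_zero_iff)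
    then have "p ^ k > 1" using p(1) prime_gt_1_nat by (intro one_less_power) auto
    then have "m < n" using \<open>m \<noteq> 0\<close> m(1) by (metis mult_less_cancel2 mult_1 neq0_conv)
    moreover have "n ^ 2 = p ^ (2 * k) * m ^ 2" 
      by (simp add: m(1) power_mult_distrib mult.commute flip: power_mult)
    moreover have "\<not> p dvd m ^ 2" using m(2) p(1) prime_dvd_power by blast
    moreover have "1 * 1 \<le> (\<Sum>i\<le>2 * k. \<chi> p ^ i) * (\<Sum>d | d dvd m ^ 2. \<chi> d)"
      using less.IH[of m] sum_powers[where k = "2 * k"] calculation by (intro mult_mono) auto
    ultimately show ?thesis
      using sum_divisors_prime_power_mult[OF mult one p(1), of "m ^ 2" "2 * k"] by simp
  qed
qed

definition L_sum :: "nat \<Rightarrow> real" where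
  "L_sum n = (\<Sum>k=1..n. \<chi> k / real k)"

lemma L_sum_tail: "m \<ge> 1 \<Longrightarrow> \<bar>\<Sum>k=m..n. \<chi> k / real k\<bar> \<le> C / real m"
  using sum_mult_antimono_bound[where a = \<chi> and C = C and f = "\<lambda>k. 1 / real k" and m = m] sum_bounded
  by (simp add: frac_le)

lemma L_sum_diff: "m \<le> n \<Longrightarrow> \<bar>L_sum n - L_sum m\<bar> \<le> C / real (Suc m)"
proof -
  assume "m \<le> n"
  then have "L_sum n = L_sum m + (\<Sum>k=Suc m..n. \<chi> k / real k)"
    by (induction n rule: dec_induct) (auto simp: L_sum_def)
  then show ?thesis using L_sum_tail[of "Suc m" n] by simp
qed

definition L1 :: real where "L1 = lim L_sum"

lemma L_sum_tendsto: "L_sum \<longlonglongrightarrow> L1"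
proof -
  have "Cauchy L_sum"
  proof (rule metric_CauchyI)
    fix e :: real assume "e > 0"
    obtain M where M: "real M > C / e" using reals_Archimedean2 by blast
    have *: "\<bar>L_sum n - L_sum m\<bar> < e" if "M \<le> m" "m \<le> n" for m n
    proof -
      have "C < e * real (Suc m)"
        using M \<open>e > 0\<close> that by (simp add: field_simps) (smt (verit) mult_left_mono of_nat_mono)
      then have "C / real (Suc m) < e" by (simp add: field_simps)
      with L_sum_diff[OF that(2)] show ?thesis by linarith
    qed
    then show "\<exists>M. \<forall>m\<ge>M. \<forall>n\<ge>M. dist (L_sum m) (L_sum n) < e"
      by (intro exI[of _ M]) (metis abs_minus_commute dist_real_def nle_le)
  qed
  then show ?thesis by (simp add: L1_def Cauchy_convergent_iff convergent_LIMSEQ_iff)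
qed

lemma L_sum_error: "\<bar>L_sum n - L1\<bar> \<le> C / real (Suc n)"
proof -
  have "(\<lambda>m. \<bar>L_sum m - L_sum n\<bar>) \<longlonglongrightarrow> \<bar>L1 - L_sum n\<bar>"
    by (intro tendsto_intros L_sum_tendsto)
  then have "\<bar>L1 - L_sum n\<bar> \<le> C / real (Suc n)"
    by (rule Lim_bounded[where M = n]) (use L_sum_diff in blast)
  then show ?thesis by (simp add: abs_minus_commute)
qed

text \<open>Since \<open>L1 = 0\<close>, \<open>L_sum X\<close> is pure truncation error. Its
  contribution disappears as X grows with t fixed, which leaves a bound independent of t.\<close>

lemma lambert_sum_upper:
  assumes "0 < t" "t < 1" "L1 = 0"
  shows "(\<Sum>n=1..X. \<chi> n * (t ^ n / (1 - t ^ n))) \<le> C / (real (Suc X) * (1 - t)) + C"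
proof -
  have "(\<Sum>n=1..X. \<chi> n * (t ^ n / (1 - t ^ n)))
      = L_sum X / (1 - t) - (\<Sum>n=1..X. \<chi> n * lambert_gap t n)"
    by (simp add: lambert_gap_def L_sum_def sum_divide_distrib algebra_simps flip: sum_subtractf)
  moreover have "\<bar>\<Sum>n=1..X. \<chi> n * lambert_gap t n\<bar> \<le> C * lambert_gap t 1"
    using assms by (intro sum_mult_antimono_bound sum_bounded lambert_gap_nonneg lambert_gap_antimono) auto
  moreover have "lambert_gap t 1 = 1"
    using assms by (simp add: lambert_gap_def field_simps)
  moreover have "L_sum X / (1 - t) \<le> C / real (Suc X) / (1 - t)"
    using L_sum_error[of X] assms by (intro divide_right_mono) auto
  ultimately show ?thesis by simp
qed

text \<open>In the power series of the truncated Lambert sum the coefficients up to X are full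
  divisor sums, and each square up to K^2 contributes at least 1/2. Beyond X the divisor sums are
  incomplete, and the crude bound X t^m per term is used.\<close>

lemma lambert_sum_lower:
  assumes t: "0 < t" "t < 1" "t ^ K\<^sup>2 \<ge> 1 / 2" and X: "K\<^sup>2 \<le> X"
  shows "real K / 2 - real X * t ^ Suc X / (1 - t) \<le> (\<Sum>n=1..X. \<chi> n * (t ^ n / (1 - t ^ n)))"
proof -
  define g where "g m = (\<Sum>n=1..X. \<chi> n * (if n dvd m \<and> m \<noteq> 0 then t ^ m else 0))" for m
  define f where "f = (\<Sum>n=1..X. \<chi> n * (t ^ n / (1 - t ^ n)))"
  have g_sums: "g sums f"
    unfolding g_def f_def using t by (intro sums_sum sums_mult sums_power_multiples) auto
  have g_eq: "g m = t ^ m * (\<Sum>d | d dvd m. \<chi> d)" if "m \<noteq> 0" "m \<le> X" for m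
  proof -
    have "g m = (\<Sum>d | d dvd m. \<chi> d * t ^ m)"
      unfolding g_def
    proof (rule sum.mono_neutral_cong_right)
      show "{d. d dvd m} \<subseteq> {1..X}"
      proof
        fix d assume "d \<in> {d. d dvd m}"
        then show "d \<in> {1..X}" using that dvd_imp_le[of d m] dvd_pos_nat[of m d] by auto
      qed
    qed (use that in auto)
    then show ?thesis by (simp add: sum_distrib_left mult.commute)
  qed
  have g_nonneg: "0 \<le> g m" if "m \<le> X" for m
    using that t g_eq[of m] sum_divisors_nonneg[of m] by (cases "m = 0") (auto simp: g_def)
  have g_square: "1 / 2 \<le> g (k\<^sup>2)" if "k \<in> {1..K}" for k
  proof -
    have kK: "k\<^sup>2 \<le> K\<^sup>2" using that by (intro power_mono) auto
    have tk: "t ^ K\<^sup>2 \<le> t ^ k\<^sup>2" using t kK by (intro power_decreasing) auto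
    then have "1 / 2 * 1 \<le> t ^ k\<^sup>2 * (\<Sum>d | d dvd k\<^sup>2. \<chi> d)"
      using order_trans[OF t(3) tk] sum_divisors_square[of k] that t by (intro mult_mono) auto
    then show ?thesis using g_eq[of "k\<^sup>2"] kK X that by simp
  qed
  have "real K / 2 \<le> (\<Sum>k=1..K. g (k\<^sup>2))"
    using sum_mono[of "{1..K}" "\<lambda>_. 1 / 2" "\<lambda>k. g (k\<^sup>2)"] g_square by simp
  also have "\<dots> = sum g ((\<lambda>k. k\<^sup>2) ` {1..K})"
    by (subst sum.reindex) (auto intro!: inj_onI)
  also have "\<dots> \<le> sum g {..<Suc X}"
  proof (intro sum_mono2)
    show "(\<lambda>k. k\<^sup>2) ` {1..K} \<subseteq> {..<Suc X}"
      using X by (auto simp: less_Suc_eq_le intro: order_trans[OF power_mono])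
  qed (auto intro: g_nonneg)
  finally have head: "real K / 2 \<le> sum g {..<Suc X}" .
  have g_tail: "- (real X * t ^ m) \<le> g m" for m
  proof -
    have "- (t ^ m) \<le> \<chi> n * (if n dvd m \<and> m \<noteq> 0 then t ^ m else 0)" for n
      using abs_le_1[of n] t mult_right_mono[of "-1" "\<chi> n" "t ^ m"] by (auto simp: abs_le_iff)
    then have "(\<Sum>n=1..X. - (t ^ m)) \<le> g m" unfolding g_def by (intro sum_mono)
    then show ?thesis by simp
  qed
  have gs: "(\<lambda>i. g (i + Suc X)) sums (f - sum g {..<Suc X})"
    by (rule sums_split_initial_segment[OF g_sums])
  have geo: "(\<lambda>i. - (real X * t ^ Suc X) * t ^ i) sums (- (real X * t ^ Suc X) * (1 / (1 - t)))"
    using t by (intro sums_mult geometric_sums) auto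
  have le: "- (real X * t ^ Suc X) * t ^ i \<le> g (i + Suc X)" for i
    using g_tail[of "i + Suc X"] by (simp add: power_add mult_ac)
  have "- (real X * t ^ Suc X) * (1 / (1 - t)) \<le> f - sum g {..<Suc X}"
    by (rule sums_le[OF le geo gs])
  with head show ?thesis by (simp add: f_def)
qed

lemma L1_nonzero: "L1 \<noteq> 0"
proof
  assume "L1 = 0"
  obtain K0 where "real K0 > 2 * C" using reals_Archimedean2 by blast
  then obtain K where K: "real K > 2 * C" "K \<ge> 1" by (intro that[of "Suc K0"]) auto
  \<comment> \<open>By Bernoulli's inequality t^(K^2) \<ge> 1/2. With this t fixed, letting X tend
    to infinity leaves K/2 \<le> C, against the choice of K.\<close>
  define t where "t = 1 - 1 / (2 * (real K)\<^sup>2)"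
  have K2: "(real K)\<^sup>2 \<ge> 1" using K by simp
  then have "1 / (2 * (real K)\<^sup>2) \<le> 1 / 2" "0 < 1 / (2 * (real K)\<^sup>2)"
    using K by (auto simp: divide_simps)
  then have t: "0 < t" "t < 1" unfolding t_def by linarith+
  have "1 + real (K\<^sup>2) * (- (1 / (2 * (real K)\<^sup>2))) \<le> (1 + (- (1 / (2 * (real K)\<^sup>2)))) ^ K\<^sup>2"
    using t by (intro Bernoulli_inequality) (simp add: t_def)
  then have "1 / 2 \<le> t ^ K\<^sup>2" using K by (simp add: t_def split: if_splits)
  then have *: "real K / 2 - real X * t ^ Suc X / (1 - t) \<le> C / (real (Suc X) * (1 - t)) + C"
    if "X \<ge> K\<^sup>2" for X
    using lambert_sum_lower[OF t _ that] lambert_sum_upper[OF t \<open>L1 = 0\<close>, of X] by linarith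
  have "(\<lambda>X. real X * t ^ X) \<longlonglongrightarrow> 0" using t by (intro powser_times_n_limit_0) auto
  then have "(\<lambda>X. real K / 2 - t / (1 - t) * (real X * t ^ X)) \<longlonglongrightarrow> real K / 2 - t / (1 - t) * 0"
    by (intro tendsto_intros)
  then have "(\<lambda>X. real K / 2 - real X * t ^ Suc X / (1 - t)) \<longlonglongrightarrow> real K / 2"
    by (simp add: mult_ac)
  moreover have "(\<lambda>X. C / (1 - t) * inverse (real (Suc X)) + C) \<longlonglongrightarrow> C / (1 - t) * 0 + C"
    by (intro tendsto_intros LIMSEQ_inverse_real_of_nat)
  then have "(\<lambda>X. C / (real (Suc X) * (1 - t)) + C) \<longlonglongrightarrow> C"
    by (simp add: field_simps)
  ultimately have "real K / 2 \<le> C"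
    using * by (intro LIMSEQ_le[where Y = "\<lambda>X. C / (real (Suc X) * (1 - t)) + C"]) auto
  with K show False by simp
qed

lemma sum_ln_bounded: "\<exists>B. \<forall>n. \<bar>\<Sum>k=1..n. \<chi> k * (ln (real k) / real k)\<bar> \<le> B"
proof (intro exI allI)
  fix n
  \<comment> \<open>ln x / x decreases only from e onwards, so the terms at 1 and 2 are estimated
    separately.\<close>
  have "\<bar>\<Sum>k=3..n. \<chi> k * (ln (real k) / real k)\<bar> \<le> C * (ln (real 3) / real 3)"
  proof (intro sum_mult_antimono_bound sum_bounded)
    fix k :: nat assume "3 \<le> k"
    then show "ln (real (Suc k)) / real (Suc k) \<le> ln (real k) / real k"
      using exp_le by (intro ln_x_over_x_mono) linarith+
  qed auto
  moreover have "\<bar>\<Sum>k=1..min 2 n. \<chi> k * (ln (real k) / real k)\<bar> \<le> (\<Sum>k=1..min 2 n. 1)"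
  proof (intro order_trans[OF sum_abs] sum_mono)
    fix k assume "k \<in> {1..min 2 n}"
    then have "\<bar>ln (real k) / real k\<bar> \<le> 1"
      using ln_le_minus_one[of "real k"] by (simp add: field_simps)
    then show "\<bar>\<chi> k * (ln (real k) / real k)\<bar> \<le> 1"
      using mult_mono[OF abs_le_1[of k]] by (simp only: abs_mult) force
  qed
  moreover have "{1..n} = {1..min 2 n} \<union> {3..n}" by auto
  then have "(\<Sum>k=1..n. \<chi> k * (ln (real k) / real k))
     = (\<Sum>k=1..min 2 n. \<chi> k * (ln (real k) / real k)) + (\<Sum>k=3..n. \<chi> k * (ln (real k) / real k))"
    by (simp only:) (rule sum.union_disjoint, auto)
  ultimately show "\<bar>\<Sum>k=1..n. \<chi> k * (ln (real k) / real k)\<bar> \<le> 2 + C * (ln (real 3) / real 3)"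
    by simp
qed

text \<open>Splitting ln k as a sum of von Mangoldt values turns the bounded sum of \<chi>(k) ln k /
  k into one of \<chi>(d) Lambda(d)/d times \<open>L_sum (n div d)\<close>. Replacing the last
  factor by \<open>L1\<close> costs at most C/n times the von Mangoldt value for each d, in all 4 C
  by Chebyshev, and then one divides by \<open>L1\<close>.\<close>

lemma sum_mangoldt_bounded: "\<exists>B. \<forall>n. \<bar>\<Sum>d=1..n. \<chi> d * mangoldt d / real d\<bar> \<le> B"
proof -
  obtain B where B: "\<And>n. \<bar>\<Sum>k=1..n. \<chi> k * (ln (real k) / real k)\<bar> \<le> B"
    using sum_ln_bounded by blast
  have "\<bar>\<Sum>d=1..n. \<chi> d * mangoldt d / real d\<bar> \<le> (B + 4 * C) / \<bar>L1\<bar>" for n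
  proof -
    let ?S = "\<Sum>d=1..n. \<chi> d * mangoldt d / real d"
    have "(\<Sum>k=1..n. \<chi> k * (ln (real k) / real k))
        = (\<Sum>k=1..n. \<Sum>d | d dvd k. \<chi> k / real k * mangoldt d)"
      by (rule sum.cong[OF refl], subst sum_distrib_left[symmetric]) (simp add: mangoldt_sum)
    also have "\<dots> = (\<Sum>d=1..n. \<chi> d * mangoldt d / real d * L_sum (n div d))"
      by (subst sum_sum_divisors) (simp add: mult L_sum_def sum_distrib_left mult_ac)
    finally have "?S * L1 = (\<Sum>k=1..n. \<chi> k * (ln (real k) / real k))
        - (\<Sum>d=1..n. \<chi> d * mangoldt d / real d * (L_sum (n div d) - L1))"
      by (simp add: sum_distrib_right right_diff_distrib sum_subtractf)
    moreover have "\<bar>\<Sum>d=1..n. \<chi> d * mangoldt d / real d * (L_sum (n div d) - L1)\<bar> \<le> 4 * C"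
    proof (cases "n = 0")
      case False
      have "\<bar>\<Sum>d=1..n. \<chi> d * mangoldt d / real d * (L_sum (n div d) - L1)\<bar>
          \<le> (\<Sum>d=1..n. mangoldt d * (C / real n))"
      proof (intro order_trans[OF sum_abs] sum_mono)
        fix d assume d: "d \<in> {1..n}"
        have "n \<le> d * Suc (n div d)" using d dividend_less_times_div[of d n] by simp
        then have "real n \<le> real d * real (Suc (n div d))" by (metis of_nat_le_iff of_nat_mult)
        then have "C / (real d * real (Suc (n div d))) \<le> C / real n"
          using False C_nonneg by (intro divide_left_mono) auto
        have "\<bar>\<chi> d * mangoldt d / real d * (L_sum (n div d) - L1)\<bar>
            = \<bar>\<chi> d\<bar> * (mangoldt d / real d) * \<bar>L_sum (n div d) - L1\<bar>"
          by (simp add: abs_mult)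
        also have "\<dots> \<le> 1 * (mangoldt d / real d) * (C / real (Suc (n div d)))"
          by (intro mult_mono abs_le_1 L_sum_error) (auto simp: mangoldt_nonneg)
        also have "\<dots> = mangoldt d * (C / (real d * real (Suc (n div d))))" by simp
        also have "\<dots> \<le> mangoldt d * (C / real n)"
          by (intro mult_left_mono mangoldt_nonneg) fact
        finally show "\<bar>\<chi> d * mangoldt d / real d * (L_sum (n div d) - L1)\<bar> \<le> mangoldt d * (C / real n)" .
      qed
      also have "\<dots> = (\<Sum>d=1..n. mangoldt d) * (C / real n)" by (rule sum_distrib_right[symmetric])
      also have "\<dots> \<le> (4 * real n) * (C / real n)"
        using C_nonneg by (intro mult_right_mono sum_mangoldt_le) auto
      also have "\<dots> = 4 * C" using False by simp
      finally show ?thesis .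
    qed (use C_nonneg in auto)
    ultimately have "\<bar>?S * L1\<bar> \<le> B + 4 * C" using B[of n] by linarith
    then show ?thesis using L1_nonzero by (simp add: abs_mult field_simps)
  qed
  then show ?thesis by blast
qed

end

section \<open>Primes with prescribed quadratic symbols\<close>

text \<open>A full period contributes 0 from any starting point, so only an incomplete period
  counts.\<close>

lemma periodic_sum_bounded:
  fixes f :: "nat \<Rightarrow> real"
  assumes per: "\<And>n. f (n + M) = f n" and zero: "(\<Sum>k<M. f k) = 0" and le: "\<And>n. \<bar>f n\<bar> \<le> 1" and "M > 0"
  shows "\<bar>\<Sum>k=m..n. f k\<bar> \<le> real M"
proof -
  have period: "(\<Sum>k<M. f (a + k)) = 0" for a
  proof (induction a)
    case (Suc a)
    have "(\<Sum>k<M. f (Suc a + k)) + f a = (\<Sum>k<Suc M. f (a + k))"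
      by (subst sum.lessThan_Suc_shift) simp
    also have "\<dots> = (\<Sum>k<M. f (a + k)) + f a" using per[of a] by simp
    finally show ?case using Suc by simp
  qed (use zero in simp)
  have *: "\<bar>\<Sum>k<l. f (a + k)\<bar> \<le> real M" for a l
  proof (induction l arbitrary: a rule: less_induct)
    case (less l)
    show ?case
    proof (cases "l < M")
      case True
      have "\<bar>\<Sum>k<l. f (a + k)\<bar> \<le> (\<Sum>k<l. 1)"
        using le by (intro order_trans[OF sum_abs] sum_mono) auto
      then show ?thesis using True by simp
    next
      case False
      have "(\<Sum>k<l. f (a + k)) = (\<Sum>k<M. f (a + k)) + (\<Sum>k=M..<l. f (a + k))"
        using False by (simp add: lessThan_atLeast0 sum.atLeastLessThan_concat)
      also have "(\<Sum>k=M..<l. f (a + k)) = (\<Sum>k<l - M. f (a + M + k))"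
        using False by (intro sum.reindex_bij_witness[of _ "\<lambda>k. k + M" "\<lambda>k. k - M"]) auto
      finally show ?thesis using less.IH[of "l - M" "a + M"] period[of a] False \<open>M > 0\<close> by simp
    qed
  qed
  have "(\<Sum>k=m..n. f k) = (\<Sum>k<Suc n - m. f (m + k))"
    by (intro sum.reindex_bij_witness[of _ "\<lambda>k. m + k" "\<lambda>k. k - m"]) auto
  with * show ?thesis by simp
qed

text \<open>Multiplication by c permutes the residues and reverses the sign of \<chi>, so the sum
  over a period equals its own negative.\<close>

lemma real_character_mod:
  fixes \<chi> :: "nat \<Rightarrow> real"
  assumes mult: "\<And>a b. \<chi> (a * b) = \<chi> a * \<chi> b" and one: "\<chi> 1 = 1" and val: "\<And>n. \<chi> n \<in> {-1, 0, 1}"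
    and per: "\<And>n. \<chi> (n mod M) = \<chi> n" and "M > 0"
    and c: "coprime c M" "\<chi> c = -1"
  shows "real_character \<chi> (real M)"
proof
  have "bij_betw (\<lambda>k. c * k mod M) {..<M} {..<M}"
  proof (rule bij_betw_imageI)
    show inj: "inj_on (\<lambda>k. c * k mod M) {..<M}"
    proof (rule inj_onI)
      fix x y assume xy: "x \<in> {..<M}" "y \<in> {..<M}" "c * x mod M = c * y mod M"
      then have "[x = y] (mod M)"
        using c(1) by (simp add: cong_def[symmetric] cong_mult_lcancel_nat)
      with xy show "x = y" by (simp add: cong_def)
    qed
    show "(\<lambda>k. c * k mod M) ` {..<M} = {..<M}"
      using \<open>M > 0\<close> by (intro endo_inj_surj inj) auto
  qed
  then have "(\<Sum>k<M. \<chi> k) = (\<Sum>k<M. \<chi> (c * k mod M))"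
    by (rule sum.reindex_bij_betw[symmetric])
  also have "\<dots> = - (\<Sum>k<M. \<chi> k)" by (simp add: per mult c(2) sum_negf)
  finally have zero: "(\<Sum>k<M. \<chi> k) = 0" by simp
  show "\<bar>\<Sum>k=m..n. \<chi> k\<bar> \<le> real M" for m n
  proof (rule periodic_sum_bounded)
    show "\<chi> (n + M) = \<chi> n" for n using per[of n] per[of "n + M"] by simp
    show "\<bar>\<chi> n\<bar> \<le> 1" for n using val[of n] by auto
  qed (use zero \<open>M > 0\<close> in auto)
qed (use mult one val in auto)

text \<open>Only a prime power is obtained, but in the application some prescribed value is \<open>-1\<close>,
  which forces the exponent to be odd, so that its prime has the same character values.\<close>

lemma exists_primepow_character_values:
  fixes X :: "'i \<Rightarrow> nat \<Rightarrow> real" and \<epsilon> :: "'i \<Rightarrow> real"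
  assumes fin: "finite I" and "M > 0"
    and mult: "\<And>i a b. i \<in> I \<Longrightarrow> X i (a * b) = X i a * X i b"
    and one: "\<And>i. i \<in> I \<Longrightarrow> X i 1 = 1"
    and val: "\<And>i n. i \<in> I \<Longrightarrow> coprime n M \<Longrightarrow> X i n \<in> {-1, 1}"
    and per: "\<And>i n. i \<in> I \<Longrightarrow> X i (n mod M) = X i n"
    and indep: "\<And>T. T \<subseteq> I \<Longrightarrow> T \<noteq> {} \<Longrightarrow> \<exists>c. coprime c M \<and> (\<Prod>i\<in>T. X i c) = -1"
    and eps: "\<And>i. i \<in> I \<Longrightarrow> \<epsilon> i \<in> {-1, 1}"
  shows "\<exists>n. primepow n \<and> coprime n M \<and> (\<forall>i\<in>I. X i n = \<epsilon> i)"
proof (rule ccontr)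
  assume none: "\<not> ?thesis"
  \<comment> \<open>All products of the given characters; \<open>T = {}\<close> is the principal
    one.\<close>
  define \<chi> where "\<chi> T n = (if coprime n M then \<Prod>i\<in>T. X i n else 0)" for T n
  have char: "real_character (\<chi> T) (real M)" if T: "T \<subseteq> I" "T \<noteq> {}" for T
  proof -
    obtain c where c: "coprime c M" "(\<Prod>i\<in>T. X i c) = -1" using indep[OF T] by blast
    have val': "(\<Prod>i\<in>T. X i n) \<in> {-1, 1}" if "coprime n M" for n
    proof -
      have "finite T" using fin T finite_subset by blast
      then show ?thesis using T(1)
      proof (induction T)
        case (insert i T)
        then show ?case using val[of i n] that by auto
      qed auto
    qed
    show ?thesis
    proof (rule real_character_mod)
      show "\<chi> T (a * b) = \<chi> T a * \<chi> T b" for a b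
        using T mult by (auto simp: \<chi>_def prod.distrib[symmetric] intro!: prod.cong)
      show "\<chi> T 1 = 1" using T one by (auto simp: \<chi>_def intro!: prod.neutral)
      show "\<chi> T n \<in> {-1, 0, 1}" for n using val' by (auto simp: \<chi>_def)
      show "\<chi> T (n mod M) = \<chi> T n" for n
        using T per by (auto simp: \<chi>_def coprime_mod_left_iff \<open>M > 0\<close> intro!: prod.cong)
    qed (use c \<open>M > 0\<close> in \<open>auto simp: \<chi>_def\<close>)
  qed
  have "\<exists>B. \<forall>n. \<bar>\<Sum>d=1..n. \<chi> T d * mangoldt d / real d\<bar> \<le> B" if "T \<in> Pow I - {{}}" for T
    using real_character.sum_mangoldt_bounded[OF char] that by blast
  then obtain B where B: "\<And>T n. T \<in> Pow I - {{}} \<Longrightarrow> \<bar>\<Sum>d=1..n. \<chi> T d * mangoldt d / real d\<bar> \<le> B T"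
    by metis
  define S where "S T n = (\<Sum>d=1..n. \<chi> T d * mangoldt d / real d)" for T n
  \<comment> \<open>Orthogonality: the product of 1 + \<epsilon>(i) X(i, d) over I expands into a
    sum over all T, and it vanishes as soon as one value differs from the prescribed one. Under the
    negated claim this happens at every prime power coprime to M.\<close>
  have zero: "(\<Sum>T\<in>Pow I. (\<Prod>i\<in>T. \<epsilon> i) * S T n) = 0" for n
  proof -
    have "(\<Sum>T\<in>Pow I. (\<Prod>i\<in>T. \<epsilon> i) * S T n)
        = (\<Sum>d=1..n. \<Sum>T\<in>Pow I. (\<Prod>i\<in>T. \<epsilon> i) * (\<chi> T d * mangoldt d / real d))"
      unfolding S_def sum_distrib_left by (rule sum.swap)
    also have "\<dots> = (\<Sum>d=1..n. 0)"
    proof (rule sum.cong[OF refl])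
      fix d
      show "(\<Sum>T\<in>Pow I. (\<Prod>i\<in>T. \<epsilon> i) * (\<chi> T d * mangoldt d / real d)) = 0"
      proof (cases "primepow d \<and> coprime d M")
        case False
        then show ?thesis by (auto simp: \<chi>_def mangoldt_def)
      next
        case True
        then obtain i where i: "i \<in> I" "X i d \<noteq> \<epsilon> i" using none by blast
        then have "1 + \<epsilon> i * X i d = 0" using val[of i d] eps[of i] True by auto
        then have "0 = (\<Prod>i\<in>I. \<epsilon> i * X i d + 1)"
          using fin i by (intro prod_zero[symmetric]) (auto simp: add.commute)
        also have "\<dots> = (\<Sum>T\<in>Pow I. \<Prod>i\<in>T. \<epsilon> i * X i d)" by (simp add: prod_add fin)
        finally have "(\<Sum>T\<in>Pow I. (\<Prod>i\<in>T. \<epsilon> i) * \<chi> T d) = 0"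
          using True by (simp add: \<chi>_def prod.distrib)
        then have "(\<Sum>T\<in>Pow I. (\<Prod>i\<in>T. \<epsilon> i) * \<chi> T d) * (mangoldt d / real d) = 0" by simp
        then show ?thesis unfolding sum_distrib_right by (simp add: mult_ac)
      qed
    qed
    finally show ?thesis by simp
  qed
  define B0 where "B0 = (\<Sum>p\<in>prime_factors M. ln (real p))"
  \<comment> \<open>The term \<open>T = {}\<close> exceeds ln n up to a constant while all other
    terms are bounded, although their combination is 0.\<close>
  have upper: "ln (real n) \<le> 1 + B0 + (\<Sum>T\<in>Pow I - {{}}. B T)" if "n \<ge> 1" for n
  proof -
    have "(\<Sum>d=1..n. mangoldt d / real d) = (\<Sum>d=1..n. (if coprime d M then mangoldt d / real d else 0)
            + (if \<not> coprime d M then mangoldt d / real d else 0))"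
      by (rule sum.cong) auto
    also have "\<dots> = S {} n + (\<Sum>d | d \<in> {1..n} \<and> \<not> coprime d M. mangoldt d / real d)"
    proof -
      have "S {} n = (\<Sum>d=1..n. if coprime d M then mangoldt d / real d else 0)"
        unfolding S_def \<chi>_def by (intro sum.cong) auto
      then show ?thesis unfolding sum.distrib by (simp add: sum.If_cases Int_def)
    qed
    finally have "ln (real n) - 1 \<le> S {} n + B0"
      using sum_mangoldt_over_ge[OF that] sum_mangoldt_not_coprime_le[of M n] \<open>M > 0\<close>
      by (simp add: B0_def)
    moreover have "S {} n = - (\<Sum>T\<in>Pow I - {{}}. (\<Prod>i\<in>T. \<epsilon> i) * S T n)"
      using zero[of n] fin by (subst (asm) sum.remove[of _ "{}"]) auto
    moreover have "\<dots> \<le> (\<Sum>T\<in>Pow I - {{}}. B T)"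
    proof (subst sum_negf[symmetric], rule sum_mono)
      fix T assume T: "T \<in> Pow I - {{}}"
      have "\<bar>\<epsilon> i\<bar> = 1" if "i \<in> T" for i
      proof -
        have "i \<in> I" using T that by auto
        with eps[of i] show ?thesis by auto
      qed
      then have "\<bar>\<Prod>i\<in>T. \<epsilon> i\<bar> = 1" by (simp add: abs_prod)
      then have "\<bar>(\<Prod>i\<in>T. \<epsilon> i) * S T n\<bar> \<le> B T" using B[OF T, of n] by (simp add: abs_mult S_def)
      then show "- ((\<Prod>i\<in>T. \<epsilon> i) * S T n) \<le> B T" by linarith
    qed
    ultimately show ?thesis by linarith
  qed
  define E where "E = 1 + B0 + (\<Sum>T\<in>Pow I - {{}}. B T)"
  obtain n where n: "exp E < real n" using reals_Archimedean2 by blast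
  then have "0 < real n" using exp_gt_zero less_trans by blast
  moreover from this n have "E < ln (real n)" by (metis exp_less_cancel_iff exp_ln)
  ultimately show False using upper[of n] by (simp add: E_def)
qed

section \<open>Legendre symbols and the characters modulo 4 and 8\<close>

lemma small_multiple_eq_0: "p dvd d \<Longrightarrow> \<bar>d\<bar> < p \<Longrightarrow> d = (0 :: int)"
  using dvd_imp_le_int[of d p] by linarith

lemma Legendre_mult:
  assumes "prime p" "2 < p"
  shows "Legendre (a * b) (int p) = Legendre a (int p) * Legendre b (int p)"
proof -
  have "[Legendre (a * b) (int p) = (a * b) ^ ((p - 1) div 2)] (mod int p)"
    by (rule euler_criterion[OF assms])
  also have "[(a * b) ^ ((p - 1) div 2) = Legendre a (int p) * Legendre b (int p)] (mod int p)"
    unfolding power_mult_distrib by (intro cong_mult cong_sym[OF euler_criterion] assms)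
  finally have "int p dvd Legendre (a * b) (int p) - Legendre a (int p) * Legendre b (int p)"
    by (simp add: cong_iff_dvd_diff)
  moreover have "\<bar>Legendre (a * b) (int p) - Legendre a (int p) * Legendre b (int p)\<bar> < int p"
    using assms by (auto simp: Legendre_def)
  ultimately show ?thesis using small_multiple_eq_0 by (metis eq_iff_diff_eq_0)
qed

lemma Legendre_mod: "Legendre (a mod p) p = Legendre a p"
  by (simp add: Legendre_def QuadRes_def cong_def)

lemma Legendre_cong: "[a = b] (mod p) \<Longrightarrow> Legendre a p = Legendre b p"
  by (metis Legendre_mod cong_def)

lemma Legendre_1: "1 < p \<Longrightarrow> Legendre 1 p = 1"
  by (auto simp: Legendre_def QuadRes_def cong_def intro!: exI[of _ 1])

lemma Legendre_values: "\<not> p dvd a \<Longrightarrow> Legendre a p \<in> {-1, 1}"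
  by (simp add: Legendre_def cong_0_iff)

text \<open>Otherwise squaring would map the nonzero residues onto themselves, hence injectively,
  but p - 1 and 1 have the same square.\<close>

lemma exists_nonresidue:
  assumes "prime p" "2 < p"
  shows "\<exists>g. coprime g p \<and> Legendre (int g) (int p) = -1"
proof (rule ccontr)
  assume none: "\<not> ?thesis"
  let ?f = "\<lambda>x. x\<^sup>2 mod p"
  have "{1..<p} \<subseteq> ?f ` {1..<p}"
  proof
    fix g assume g: "g \<in> {1..<p}"
    then have "\<not> p dvd g" by (auto dest: dvd_imp_le)
    then have "coprime g p" using assms prime_imp_coprime coprime_commute by blast
    then have "Legendre (int g) (int p) = 1" 
      using none Legendre_values[of "int p" "int g"] \<open>\<not> p dvd g\<close> by auto
    then obtain y where "[y\<^sup>2 = int g] (mod int p)"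
      by (auto simp: Legendre_def QuadRes_def split: if_splits)
    then have "[(int (nat (y mod int p)))\<^sup>2 = int g] (mod int p)"
      using assms by (simp add: cong_def power_mod)
    then have y: "[(nat (y mod int p))\<^sup>2 = g] (mod p)"
      by (metis cong_int_iff of_nat_power)
    then have "?f (nat (y mod int p)) = g" using g by (simp add: cong_def)
    moreover have "nat (y mod int p) \<noteq> 0" using calculation g by (intro notI) simp
    moreover have "nat (y mod int p) < p" using assms by (simp add: nat_less_iff)
    ultimately show "g \<in> ?f ` {1..<p}" by (intro image_eqI[of _ _ "nat (y mod int p)"]) auto
  qed
  then have "inj_on ?f {1..<p}" by (intro finite_surj_inj) auto
  moreover have "?f (p - 1) = ?f 1"
  proof -
    have "int p dvd (int p - 1)\<^sup>2 - 1" by (simp add: power2_eq_square algebra_simps)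
    moreover have "int ((p - 1)\<^sup>2) = (int p - 1)\<^sup>2" using assms by (simp add: of_nat_diff)
    ultimately have "[int ((p - 1)\<^sup>2) = int (1\<^sup>2)] (mod int p)" by (simp add: cong_iff_dvd_diff)
    then have "[(p - 1)\<^sup>2 = 1\<^sup>2] (mod p)" by (simp only: cong_int_iff)
    then show ?thesis by (simp add: cong_def)
  qed
  ultimately have "p - 1 = 1" by (rule inj_onD) (use assms in auto)
  with assms show False by simp
qed

text \<open>Besides the Legendre symbols at odd primes, the indices 4 and 8, which are not primes,
  stand for the characters \<open>(-1/n)\<close> and \<open>(2/n)\<close> modulo 4 and 8.\<close>

definition residue_symbol :: "nat \<Rightarrow> nat \<Rightarrow> real" where
  "residue_symbol i n =
    (if i = 4 then (if even n then 0 else if n mod 4 = 1 then 1 else -1)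
     else if i = 8 then (if even n then 0 else if n mod 8 = 1 \<or> n mod 8 = 7 then 1 else -1)
     else of_int (Legendre (int n) (int i)))"

lemma residue_symbol_4_mult: "residue_symbol 4 (a * b) = residue_symbol 4 a * residue_symbol 4 b"
proof -
  define f :: "nat \<Rightarrow> real" where "f r = (if r = 1 then 1 else if r = 3 then -1 else 0)" for r
  have eq: "residue_symbol 4 n = f (n mod 4)" for n
    by (auto simp: residue_symbol_def f_def; presburger)
  have "\<forall>r\<in>{0, 1, 2, 3}. \<forall>s\<in>{0, 1, 2, 3}. f (r * s mod 4) = f r * f s" by (simp add: f_def)
  moreover have "n mod 4 \<in> {0, 1, 2, 3}" for n :: nat by auto
  ultimately have "f ((a mod 4) * (b mod 4) mod 4) = f (a mod 4) * f (b mod 4)" by blast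
  then show ?thesis by (simp add: eq mod_mult_eq)
qed

lemma residue_symbol_8_mult: "residue_symbol 8 (a * b) = residue_symbol 8 a * residue_symbol 8 b"
proof -
  define f :: "nat \<Rightarrow> real"
    where "f r = (if r = 1 \<or> r = 7 then 1 else if r = 3 \<or> r = 5 then -1 else 0)" for r
  have eq: "residue_symbol 8 n = f (n mod 8)" for n
    by (auto simp: residue_symbol_def f_def; presburger)
  have "\<forall>r\<in>{0, 1, 2, 3, 4, 5, 6, 7}. \<forall>s\<in>{0, 1, 2, 3, 4, 5, 6, 7}. f (r * s mod 8) = f r * f s"
    by (simp add: f_def)
  moreover have "n mod 8 \<in> {0, 1, 2, 3, 4, 5, 6, 7}" for n :: nat by auto
  ultimately have "f ((a mod 8) * (b mod 8) mod 8) = f (a mod 8) * f (b mod 8)" by blast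
  then show ?thesis by (simp add: eq mod_mult_eq)
qed

lemma exists_prime_with_residue_symbols:
  fixes Q :: "nat set" and \<epsilon> :: "nat \<Rightarrow> int"
  assumes fin: "finite Q" and Q: "\<And>q. q \<in> Q \<Longrightarrow> prime q \<and> 2 < q"
    and eps: "\<And>q. q \<in> Q \<Longrightarrow> \<epsilon> q \<in> {-1, 1}"
  shows "\<exists>m. prime m \<and> m mod 8 = 3 \<and> (\<forall>q\<in>Q. Legendre (int m) (int q) = \<epsilon> q)"
proof -
  define P where "P = \<Prod>Q"
  define I where "I = insert 4 (insert 8 Q)"
  \<comment> \<open>The value -1 at both 4 and 8 singles out the class 3 modulo 8.\<close>
  define e where "e i = (if i = 4 \<or> i = 8 then -1 else real_of_int (\<epsilon> i))" for i
  have not48: "4 \<notin> Q" "8 \<notin> Q" using Q by force+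
  have odd_Q: "odd q" if "q \<in> Q" for q using Q[OF that] prime_odd_nat by auto
  have P: "P > 0" unfolding P_def using Q by (intro prod_pos) (auto intro: prime_gt_0_nat)
  have coprime_8: "coprime 8 x" if "odd x" for x :: nat
    using that coprime_power_left_iff[of 2 3 x] by simp
  have "odd P" unfolding P_def using odd_Q by (metis even_prod_iff fin)
  then have cop_P: "coprime 8 P" by (rule coprime_8)
  have symbol_Q: "residue_symbol q n = of_int (Legendre (int n) (int q))" if "q \<in> Q" for q n
    using that not48 by (auto simp: residue_symbol_def)
  have dvd_P: "q dvd P" if "q \<in> Q" for q unfolding P_def using fin that by (rule dvd_prodI)
  have symbol_1: "residue_symbol i 1 = 1" if "i \<in> I" for i
  proof (cases "i \<in> Q")
    case True
    then show ?thesis using Q[OF True] Legendre_1[of "int i"] by (simp add: symbol_Q)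
  next
    case False
    then show ?thesis using that by (auto simp: I_def residue_symbol_def)
  qed
  have "\<exists>n. primepow n \<and> coprime n (8 * P) \<and> (\<forall>i\<in>I. residue_symbol i n = e i)"
  proof (rule exists_primepow_character_values)
    show "finite I" using fin by (simp add: I_def)
    show "0 < 8 * P" using P by simp
    show "residue_symbol i (a * b) = residue_symbol i a * residue_symbol i b" if "i \<in> I" for i a b
      using that Q residue_symbol_4_mult residue_symbol_8_mult Legendre_mult
      by (auto simp: I_def symbol_Q)
    show "residue_symbol i 1 = 1" if "i \<in> I" for i by (rule symbol_1[OF that])
    show "residue_symbol i n \<in> {-1, 1}" if "i \<in> I" "coprime n (8 * P)" for i n
    proof (cases "i \<in> Q")
      case True
      then have "coprime n i"
        using dvd_P by (intro coprime_divisors[OF dvd_refl _ that(2)] dvd_mult)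
      moreover have "i \<noteq> 1" using Q[OF True] by auto
      ultimately have "\<not> i dvd n" by (metis coprime_absorb_right coprime_commute nat_dvd_1_iff_1)
      then have "Legendre (int n) (int i) \<in> {-1, 1}" by (intro Legendre_values) simp
      then show ?thesis unfolding symbol_Q[OF True] by auto
    next
      case False
      moreover have "odd n" using that(2) by (auto simp: coprime_right_2_iff_odd)
      ultimately show ?thesis using that(1) by (auto simp: I_def residue_symbol_def)
    qed
    show "residue_symbol i (n mod (8 * P)) = residue_symbol i n" if "i \<in> I" for i n
    proof (cases "i \<in> Q")
      case True
      then have "n mod (8 * P) mod i = n mod i" using dvd_P by (simp add: mod_mod_cancel)
      then have "[int (n mod (8 * P)) = int n] (mod int i)" by (simp add: cong_def flip: of_nat_mod)
      then show ?thesis using symbol_Q[OF True] Legendre_cong by metis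
    next
      case False
      have "n mod (8 * P) mod 8 = n mod 8" "n mod (8 * P) mod 4 = n mod 4" "even (n mod (8 * P)) = even n"
        by (auto simp: mod_mod_cancel dvd_mod_iff)
      with False that show ?thesis by (auto simp: I_def residue_symbol_def)
    qed
    show "e i \<in> {-1, 1}" if "i \<in> I" for i
      using that eps by (force simp: I_def e_def)
    show "\<exists>c. coprime c (8 * P) \<and> (\<Prod>i\<in>T. residue_symbol i c) = -1" if T: "T \<subseteq> I" "T \<noteq> {}" for T
    proof -
      have finT: "finite T" using T fin by (auto simp: I_def intro: finite_subset)
      have *: "(\<Prod>i\<in>T. residue_symbol i c) = -1" 
        if "j \<in> T" "residue_symbol j c = -1" "\<And>i. i \<in> T \<Longrightarrow> i \<noteq> j \<Longrightarrow> residue_symbol i c = 1" for c j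
        using finT that by (simp add: prod.remove[of T j])
      show ?thesis
      proof (cases "T \<inter> Q = {}")
        case False
        then obtain q where q: "q \<in> T" "q \<in> Q" by blast
        \<comment> \<open>The modulus without q: a number that is 1 modulo \<open>R\<close> and a
          non-residue modulo q has symbol -1 at q and 1 at all other indices.\<close>
        define R where "R = 8 * \<Prod>(Q - {q})"
        have MR: "8 * P = R * q" unfolding P_def R_def using fin q by (simp add: prod.remove[of Q q])
        have cop: "coprime q p" if "p \<in> Q - {q}" for p
          using primes_coprime[of q p] Q[of p] Q[OF q(2)] that by auto
        have "coprime q (\<Prod>(Q - {q}))" by (intro prod_coprime_right cop)
        moreover have "coprime q 8" using coprime_8[OF odd_Q[OF q(2)]] by (simp add: coprime_commute)
        ultimately have "coprime R q" by (simp add: R_def coprime_commute)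
        obtain g where g: "coprime g q" "Legendre (int g) (int q) = -1"
          using exists_nonresidue Q[OF q(2)] by blast
        obtain c where c: "[c = 1] (mod R)" "[c = g] (mod q)"
          using binary_chinese_remainder_nat[OF \<open>coprime R q\<close>] by blast
        have "coprime c R" using c(1) by (metis cong_imp_coprime cong_sym coprime_1_left)
        moreover have "coprime c q" using c(2) g(1) by (metis cong_imp_coprime cong_sym)
        ultimately have "coprime c (8 * P)" by (simp add: MR)
        moreover have "(\<Prod>i\<in>T. residue_symbol i c) = -1"
        proof (rule *[OF q(1)])
          have "[int c = int g] (mod int q)" using c(2) by (simp add: cong_int_iff)
          then show "residue_symbol q c = -1"
            using symbol_Q[OF q(2)] g(2) Legendre_cong[of "int c" "int g" "int q"] by simp
          fix i assume i: "i \<in> T" "i \<noteq> q"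
          show "residue_symbol i c = 1"
          proof (cases "i \<in> Q")
            case True
            then have "i dvd \<Prod>(Q - {q})" using fin i by (intro dvd_prodI) auto
            then have "[c = 1] (mod i)" using c(1) by (auto simp: R_def intro: cong_dvd_modulus_nat)
            then have "[int c = 1] (mod int i)" by (metis cong_int_iff of_nat_1)
            then have "Legendre (int c) (int i) = 1"
              using Legendre_cong[of "int c" 1 "int i"] Legendre_1[of "int i"] Q[OF True] by simp
            then show ?thesis by (simp add: symbol_Q[OF True])
          next
            case False
            have "[c = 1] (mod 8)" using c(1) by (auto simp: R_def intro: cong_dvd_modulus_nat)
            then have "c mod 8 = 1" by (simp add: cong_def)
            moreover have "c mod 4 = c mod 8 mod 4" "odd c \<longleftrightarrow> odd (c mod 8)"
              by (simp_all add: mod_mod_cancel dvd_mod_iff)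
            ultimately show ?thesis using False i T by (auto simp: I_def residue_symbol_def)
          qed
        qed
        ultimately show ?thesis by blast
      next
        case True
        then have T48: "T \<subseteq> {4, 8}" using T by (auto simp: I_def)
        define j :: nat where "j = (if 8 \<in> T then 8 else 4)"
        \<comment> \<open>5 has symbol 1 at index 4 and -1 at index 8, so it serves whether or not 4
          is in \<open>T\<close>; without 8 only \<open>T = {4}\<close> remains, and 7 has symbol -1
          at 4.\<close>
        obtain c where c: "[c = (if 8 \<in> T then 5 else 7)] (mod 8)" "[c = 1] (mod P)"
          using binary_chinese_remainder_nat[OF cop_P] by blast
        have c8: "c mod 8 = (if 8 \<in> T then 5 else 7)" using c(1) by (auto simp: cong_def)
        then have "c mod 8 = 5 \<or> c mod 8 = 7" by auto
        then have "odd c" by presburger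
        then have "coprime c 8" by (subst coprime_commute) (rule coprime_8)
        moreover have "coprime c P" using c(2) by (metis cong_imp_coprime cong_sym coprime_1_left)
        ultimately have "coprime c (8 * P)" by simp
        moreover have "(\<Prod>i\<in>T. residue_symbol i c) = -1"
        proof (rule *[of j])
          show "j \<in> T" using T48 T by (auto simp: j_def)
          have "c mod 4 = c mod 8 mod 4" by (simp add: mod_mod_cancel)
          then have c4: "c mod 4 = (if 8 \<in> T then 1 else 3)" by (simp add: c8)
          show "residue_symbol j c = -1" using c8 c4 \<open>odd c\<close> by (auto simp: j_def residue_symbol_def)
          fix i assume "i \<in> T" "i \<noteq> j"
          then have "i = 4" "8 \<in> T" using T48 by (auto simp: j_def split: if_splits)
          then show "residue_symbol i c = 1" using c4 \<open>odd c\<close> by (simp add: residue_symbol_def)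
        qed
        ultimately show ?thesis by blast
      qed
    qed
  qed
  then obtain n where n: "primepow n" "\<And>i. i \<in> I \<Longrightarrow> residue_symbol i n = e i" by blast
  then obtain m k where mk: "prime m" "k > 0" "n = m ^ k" by (auto simp: primepow_def)
  have pow: "residue_symbol i n = residue_symbol i m ^ k" if "i \<in> I" for i
  proof -
    have "residue_symbol i (m ^ j) = residue_symbol i m ^ j" for j
    proof (induction j)
      case 0
      then show ?case using symbol_1[OF that] by simp
    next
      case (Suc j)
      then show ?case using that Q residue_symbol_4_mult residue_symbol_8_mult Legendre_mult
        by (auto simp: I_def symbol_Q)
    qed
    then show ?thesis by (simp add: mk)
  qed
  have val: "residue_symbol i m \<in> {-1, 0, 1}" for i
    by (auto simp: residue_symbol_def Legendre_def)
  have e4: "residue_symbol 4 m ^ k = -1" using pow[of 4] n(2)[of 4] by (simp add: I_def e_def)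
  have "odd k"
  proof
    assume "even k"
    then have "residue_symbol 4 m ^ k \<ge> 0" by (simp add: zero_le_even_power)
    with e4 show False by simp
  qed
  then have pow_k: "x ^ k = x" if "x \<in> {-1, 0, 1}" for x :: real
    using that \<open>k > 0\<close> by auto
  have sym: "residue_symbol i m = e i" if "i \<in> I" for i
    using pow[OF that] n(2)[OF that] pow_k[OF val] by simp
  have "m mod 8 = 3"
  proof -
    have "odd m" "m mod 4 \<noteq> 1" using sym[of 4] by (auto simp: I_def e_def residue_symbol_def split: if_splits)
    moreover have "m mod 8 \<noteq> 1 \<and> m mod 8 \<noteq> 7" 
      using sym[of 8] by (auto simp: I_def e_def residue_symbol_def split: if_splits)
    moreover have "m mod 8 \<in> {0, 1, 2, 3, 4, 5, 6, 7}" by auto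
    moreover have "m mod 4 = m mod 8 mod 4" "odd m \<longleftrightarrow> odd (m mod 8)"
      by (simp_all add: mod_mod_cancel dvd_mod_iff)
    ultimately show ?thesis by auto
  qed
  moreover have "Legendre (int m) (int q) = \<epsilon> q" if "q \<in> Q" for q
    using sym[of q] that not48 symbol_Q[OF that] by (auto simp: I_def e_def split: if_splits)
  ultimately show ?thesis using mk(1) by blast
qed

section \<open>Solvability of conics\<close>

lemma int_sqrt_bounds:
  fixes x :: int
  assumes "x \<ge> 0"
  obtains s where "s \<ge> 0" "s\<^sup>2 \<le> x" "x < (s + 1)\<^sup>2"
proof
  let ?s = "\<lfloor>sqrt (of_int x)\<rfloor>"
  show "?s \<ge> 0" using assms by simp
  have "(of_int ?s)\<^sup>2 \<le> (sqrt (of_int x))\<^sup>2" using assms by (intro power_mono) auto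
  then have "real_of_int (?s\<^sup>2) \<le> real_of_int x" using assms by simp
  then show "?s\<^sup>2 \<le> x" by (simp only: of_int_le_iff)
  have "(sqrt (of_int x))\<^sup>2 < (of_int ?s + 1)\<^sup>2" using assms by (intro power_strict_mono) auto
  then have "real_of_int x < real_of_int ((?s + 1)\<^sup>2)" using assms by simp
  then show "x < (?s + 1)\<^sup>2" by (simp only: of_int_less_iff)
qed

text \<open>Thue's argument in three variables: a box with sides the square roots of K D, K and D
  has volume K D. Rounding the sides down but counting both endpoints gives more than K D lattice
  points, so two of them agree modulo K D.\<close>

lemma pigeonhole_linear_form:
  fixes K D \<alpha> \<beta> :: int
  assumes "K > 0" "D > 0"
  obtains A E t where "(A, E, t) \<noteq> (0, 0, 0)" "K * D dvd A - \<alpha> * E - \<beta> * t"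
    "A\<^sup>2 \<le> K * D" "E\<^sup>2 \<le> K" "t\<^sup>2 \<le> D"
proof -
  obtain a where a: "a \<ge> 0" "a\<^sup>2 \<le> K * D" "K * D < (a + 1)\<^sup>2"
    using int_sqrt_bounds[of "K * D"] assms by auto
  obtain e where e: "e \<ge> 0" "e\<^sup>2 \<le> K" "K < (e + 1)\<^sup>2"
    using int_sqrt_bounds[of K] assms by auto
  obtain c where c: "c \<ge> 0" "c\<^sup>2 \<le> D" "D < (c + 1)\<^sup>2"
    using int_sqrt_bounds[of D] assms by auto
  let ?S = "{0..a} \<times> {0..e} \<times> {0..c}" and ?f = "\<lambda>(A, E, t). (A - \<alpha> * E - \<beta> * t) mod (K * D)"
  have "(K * D)\<^sup>2 = (K * D) * (K * D)" by (simp add: power2_eq_square)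
  also have "\<dots> < (a + 1)\<^sup>2 * ((e + 1)\<^sup>2 * (c + 1)\<^sup>2)"
    using a e c assms by (intro mult_strict_mono) auto
  also have "\<dots> = ((a + 1) * (e + 1) * (c + 1))\<^sup>2" by (simp add: power_mult_distrib)
  finally have "K * D < (a + 1) * (e + 1) * (c + 1)"
    by (rule power2_less_imp_less) (intro mult_nonneg_nonneg; use a(1) e(1) c(1) in linarith)
  also have "\<dots> = int (card ?S)" using a e c by simp
  finally have "int (card {0..<K * D}) < int (card ?S)" using assms by simp
  moreover have "?f ` ?S \<subseteq> {0..<K * D}" using assms by auto
  then have "card (?f ` ?S) \<le> card {0..<K * D}" by (intro card_mono) auto
  ultimately have "card (?f ` ?S) < card ?S" by linarith
  then have "\<not> inj_on ?f ?S" by (rule pigeonhole)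
  then obtain x y where xy: "x \<in> ?S" "y \<in> ?S" "x \<noteq> y" "?f x = ?f y" by (auto simp: inj_on_def)
  obtain A1 E1 t1 A2 E2 t2 where eq: "x = (A1, E1, t1)" "y = (A2, E2, t2)" by (metis prod_cases3)
  have sq: "(u - v)\<^sup>2 \<le> M" if "u \<in> {0..s}" "v \<in> {0..s}" "s\<^sup>2 \<le> M" for u v s M :: int
  proof -
    have "\<bar>u - v\<bar>\<^sup>2 \<le> s\<^sup>2" using that by (intro power_mono) auto
    then show ?thesis using that by simp
  qed
  show ?thesis
  proof (rule that)
    show "(A1 - A2, E1 - E2, t1 - t2) \<noteq> (0, 0, 0)" using xy eq by auto
    have "K * D dvd (A1 - \<alpha> * E1 - \<beta> * t1) - (A2 - \<alpha> * E2 - \<beta> * t2)"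
      using xy(4) eq by (simp add: mod_eq_dvd_iff)
    then show "K * D dvd (A1 - A2) - \<alpha> * (E1 - E2) - \<beta> * (t1 - t2)"
      by (simp add: algebra_simps)
  qed (use xy eq sq a e c in auto)
qed

lemma square_factor_imp_square:
  fixes D A E :: int
  assumes "D * E\<^sup>2 = A\<^sup>2" "E \<noteq> 0"
  shows "\<exists>s. D = s\<^sup>2"
proof -
  have "E\<^sup>2 dvd A\<^sup>2" using assms(1) by (metis dvd_triv_right)
  then have "E dvd A" by simp
  then obtain s where "A = E * s" by (elim dvdE)
  then show ?thesis using assms by (auto simp: power_mult_distrib)
qed

text \<open>A case of Legendre's theorem. The congruence A = \<alpha> E + \<beta> t reads A = u E
  modulo K and A = v t modulo D, which makes \<open>W\<close> a multiple of K D; the size bounds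
  leave only the quotients -1, 0, 1, 2. The extreme values force equality in the bounds and thereby
  D to be a square.\<close>

lemma conic_solvable:
  fixes K D u v :: int
  assumes pos: "K > 0" "D > 0" and cop: "coprime K D" and nonsq: "\<nexists>s. D = s\<^sup>2"
    and u: "K dvd u\<^sup>2 + D" and v: "D dvd v\<^sup>2 - K"
  shows "\<exists>A E t. t \<noteq> 0 \<and> K * t\<^sup>2 = A\<^sup>2 + D * E\<^sup>2"
proof -
  obtain \<alpha> where \<alpha>: "[\<alpha> = u] (mod K)" "[\<alpha> = 0] (mod D)"
    using binary_chinese_remainder_int[OF cop] by blast
  obtain \<beta> where \<beta>: "[\<beta> = 0] (mod K)" "[\<beta> = v] (mod D)"
    using binary_chinese_remainder_int[OF cop] by blast
  obtain A E t where nz: "(A, E, t) \<noteq> (0, 0, 0)" and dvd: "K * D dvd A - \<alpha> * E - \<beta> * t"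
    and le: "A\<^sup>2 \<le> K * D" "E\<^sup>2 \<le> K" "t\<^sup>2 \<le> D"
    using pigeonhole_linear_form[OF pos] by blast
  define W where "W = A\<^sup>2 + D * E\<^sup>2 - K * t\<^sup>2"
  have "K dvd W"
  proof -
    have "[A = \<alpha> * E + \<beta> * t] (mod K)"
      using dvd by (simp add: cong_iff_dvd_diff diff_diff_eq dvd_mult_left)
    also have "[\<alpha> * E + \<beta> * t = u * E + 0 * t] (mod K)"
      by (intro cong_add cong_mult \<alpha> \<beta> cong_refl)
    finally have "[A\<^sup>2 + D * E\<^sup>2 - K * t\<^sup>2 = (u * E + 0 * t)\<^sup>2 + D * E\<^sup>2 - 0 * t\<^sup>2] (mod K)"
      by (intro cong_add cong_diff cong_pow cong_mult cong_refl) (auto simp: cong_0_iff)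
    moreover have "(u * E + 0 * t)\<^sup>2 + D * E\<^sup>2 - 0 * t\<^sup>2 = (u\<^sup>2 + D) * E\<^sup>2"
      by (simp add: algebra_simps power_mult_distrib)
    ultimately show ?thesis using u unfolding W_def by (metis cong_dvd_iff dvd_mult2)
  qed
  moreover have "D dvd W"
  proof -
    have "[A = \<alpha> * E + \<beta> * t] (mod D)"
      using dvd by (simp add: cong_iff_dvd_diff diff_diff_eq dvd_mult_right)
    also have "[\<alpha> * E + \<beta> * t = 0 * E + v * t] (mod D)"
      by (intro cong_add cong_mult \<alpha> \<beta> cong_refl)
    finally have "[A\<^sup>2 + D * E\<^sup>2 - K * t\<^sup>2 = (0 * E + v * t)\<^sup>2 + 0 * E\<^sup>2 - K * t\<^sup>2] (mod D)"
      by (intro cong_add cong_diff cong_pow cong_mult cong_refl) (auto simp: cong_0_iff)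
    moreover have "(0 * E + v * t)\<^sup>2 + 0 * E\<^sup>2 - K * t\<^sup>2 = (v\<^sup>2 - K) * t\<^sup>2"
      by (simp add: algebra_simps power_mult_distrib)
    ultimately show ?thesis using v unfolding W_def by (metis cong_dvd_iff dvd_mult2)
  qed
  ultimately have "K * D dvd W" using cop by (rule divides_mult)
  then obtain j where j: "W = K * D * j" by (elim dvdE)
  have KD: "K * D > 0" using pos by simp
  have "D * E\<^sup>2 \<le> K * D" "K * t\<^sup>2 \<le> K * D" using le pos by (auto simp: mult.commute[of K] mult_left_mono mult_right_mono)
  moreover have "0 \<le> D * E\<^sup>2" "0 \<le> K * t\<^sup>2" "0 \<le> A\<^sup>2" using pos by auto
  ultimately have *: "- (K * D) \<le> W" "W \<le> 2 * (K * D)" unfolding W_def using le(1) by linarith+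
  then have "K * D * (-1) \<le> K * D * j" "K * D * j \<le> K * D * 2" using j by auto
  then have "-1 \<le> j" "j \<le> 2" using KD by (simp_all only: mult_le_cancel_left_pos)
  then consider "j = -1" | "j = 0" | "j = 1" | "j = 2" by linarith
  then show ?thesis
  proof cases
    case 1
    then have "W = - (K * D)" using j by simp
    then have "K * D \<le> K * t\<^sup>2" unfolding W_def using \<open>0 \<le> D * E\<^sup>2\<close> \<open>0 \<le> A\<^sup>2\<close> by linarith
    then have "D \<le> t\<^sup>2" using pos(1) by (simp only: mult_le_cancel_left_pos)
    then have "D = t\<^sup>2" using le(3) by linarith
    then show ?thesis using nonsq by blast
  next
    case 2
    then have *: "K * t\<^sup>2 = A\<^sup>2 + D * E\<^sup>2" using j by (simp add: W_def)
    have "t \<noteq> 0"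
    proof
      assume "t = 0"
      then have "A\<^sup>2 + D * E\<^sup>2 = 0" using * by simp
      then have "A\<^sup>2 = 0" "D * E\<^sup>2 = 0" using \<open>0 \<le> D * E\<^sup>2\<close> \<open>0 \<le> A\<^sup>2\<close> by linarith+
      then show False using nz pos \<open>t = 0\<close> by simp
    qed
    with * show ?thesis by blast
  next
    case 3
    then have "K * (t\<^sup>2 + D) = A\<^sup>2 + D * E\<^sup>2" using j by (simp add: W_def algebra_simps)
    \<comment> \<open>Both sides of \<open>K (t\<^sup>2 + D) = A\<^sup>2 + D E\<^sup>2\<close> are multiplied by \<open>t\<^sup>2 + D\<close>, itself a value of the
      multiplicative norm form on the right.\<close>
    then have "K * (t\<^sup>2 + D)\<^sup>2 = (A\<^sup>2 + D * E\<^sup>2) * (t\<^sup>2 + D)" by (simp add: power2_eq_square)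
    also have "\<dots> = (A * t - D * E)\<^sup>2 + D * (A + t * E)\<^sup>2" by (simp add: power2_eq_square algebra_simps)
    finally have "K * (t\<^sup>2 + D)\<^sup>2 = (A * t - D * E)\<^sup>2 + D * (A + t * E)\<^sup>2" .
    moreover have "t\<^sup>2 + D \<noteq> 0" using pos by (smt (verit) zero_le_power2)
    ultimately show ?thesis by blast
  next
    case 4
    then have "W = 2 * (K * D)" using j by simp
    then have "A\<^sup>2 = K * D" "D * E\<^sup>2 = K * D"
      using le(1) \<open>D * E\<^sup>2 \<le> K * D\<close> \<open>0 \<le> K * t\<^sup>2\<close> unfolding W_def by linarith+
    then have "D * E\<^sup>2 = A\<^sup>2" "E \<noteq> 0" using KD by auto
    then show ?thesis using square_factor_imp_square nonsq by blast
  qed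
qed

section \<open>Special values and comparison of Legendre symbols\<close>

lemma Legendre_eqI:
  assumes "[Legendre a (int p) = s] (mod int p)" "s \<in> {-1, 0, 1}" "2 < p"
  shows "Legendre a (int p) = s"
proof -
  have "int p dvd Legendre a (int p) - s" using assms(1) by (simp add: cong_iff_dvd_diff)
  moreover have "\<bar>Legendre a (int p) - s\<bar> < int p" using assms by (auto simp: Legendre_def)
  ultimately show ?thesis using small_multiple_eq_0 by (metis eq_iff_diff_eq_0)
qed

lemma Legendre_minus_1:
  assumes "prime p" "2 < p"
  shows "Legendre (-1) (int p) = (-1) ^ ((p - 1) div 2)"
proof (rule Legendre_eqI[OF euler_criterion[OF assms] _ assms(2)])
  show "(-1 :: int) ^ ((p - 1) div 2) \<in> {-1, 0, 1}"
    by (cases "even ((p - 1) div 2)") (simp_all only: neg_one_even_power neg_one_odd_power insert_iff simp_thms)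
qed

text \<open>Gauss's lemma for p = 8k + 3: of 2, 4, ..., p - 1 those above 4k + 1 are the doubles of
  2k + 1, ..., 4k + 1, and their number 2k + 1 is odd.\<close>

lemma Legendre_2_mod_8_eq_3:
  assumes "prime p" "p mod 8 = 3"
  shows "Legendre 2 (int p) = -1"
proof -
  have p: "2 < p" using assms(2) mod_less_eq_dividend[of p 8] by linarith
  interpret GAUSS p 2
    using assms p by unfold_locales (auto simp: cong_0_iff dest: zdvd_imp_le)
  define k where "k = int p div 8"
  have p_eq: "int p = 8 * k + 3" using assms(2) unfolding k_def by presburger
  have h: "(int p - 1) div 2 = 4 * k + 1" unfolding p_eq by simp
  have "k \<ge> 0" by (simp add: k_def)
  have "E = (\<lambda>x. x * 2) ` {2 * k + 1..4 * k + 1}"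
  proof -
    have "C = (\<lambda>x. x * 2) ` A"
      unfolding C_def B_def image_image A_def h by (intro image_cong refl) (auto simp: p_eq)
    then show ?thesis unfolding E_def A_def h using \<open>k \<ge> 0\<close> by auto
  qed
  then have "card E = nat (2 * k + 1)" by (simp add: card_image inj_on_def)
  moreover have "odd (nat (2 * k + 1))" using \<open>k \<ge> 0\<close> by (simp add: even_nat_iff)
  ultimately show ?thesis using gauss_lemma by simp
qed

lemma squarefree_sqrt_mod:
  fixes K :: nat
  assumes "squarefree K" "\<And>q. prime q \<Longrightarrow> q dvd K \<Longrightarrow> \<exists>u. int q dvd u\<^sup>2 + c"
  shows "\<exists>u. int K dvd u\<^sup>2 + c"
  using assms
proof (induction K rule: less_induct)
  case (less K)
  show ?case
  proof (cases "K = 1")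
    case False
    then obtain q where q: "prime q" "q dvd K" using prime_factor_nat by blast
    then obtain L where L: "K = q * L" by (elim dvdE)
    have "K \<noteq> 0" using less.prems(1) by (metis not_squarefree_0)
    have "coprime q L"
    proof (rule prime_imp_coprime[OF q(1)])
      show "\<not> q dvd L"
      proof
        assume "q dvd L"
        then have "q\<^sup>2 dvd K" by (simp add: L power2_eq_square)
        then show False using less.prems(1) q(1) by (auto dest: squarefreeD)
      qed
    qed
    moreover have "squarefree L" using less.prems(1) L squarefree_multD by blast
    moreover have "L < K" using L \<open>K \<noteq> 0\<close> prime_gt_1_nat[OF q(1)] by simp
    ultimately obtain w where w: "int L dvd w\<^sup>2 + c" using less L by (metis dvd_mult)
    obtain x where x: "int q dvd x\<^sup>2 + c" using less.prems(2) q by blast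
    have cop: "coprime (int q) (int L)" using \<open>coprime q L\<close> by simp
    then obtain u where u: "[u = x] (mod int q)" "[u = w] (mod int L)"
      using binary_chinese_remainder_int by blast
    have "[u\<^sup>2 + c = x\<^sup>2 + c] (mod int q)" "[u\<^sup>2 + c = w\<^sup>2 + c] (mod int L)"
      using u by (auto intro: cong_add cong_pow)
    then have "int q dvd u\<^sup>2 + c" "int L dvd u\<^sup>2 + c" using x w by (auto simp: cong_dvd_iff)
    then have "int q * int L dvd u\<^sup>2 + c" using cop by (intro divides_mult)
    then show ?thesis by (auto simp: L)
  qed auto
qed

text \<open>Applied to the moduli m and 5, so that (K/m) can be read off K modulo 5.\<close>

lemma Legendre_eq_if_prime_factors:
  assumes p: "prime p" "2 < p" and r: "prime r" "2 < r" and "n \<noteq> 0"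
    and eq: "\<And>q. prime q \<Longrightarrow> q dvd n \<Longrightarrow> Legendre (int q) (int p) = Legendre (int q) (int r)"
  shows "Legendre (int n) (int p) = Legendre (int n) (int r)"
  using \<open>n \<noteq> 0\<close> eq
proof (induction n rule: less_induct)
  case (less n)
  show ?case
  proof (cases "n = 1")
    case True
    then show ?thesis using p r Legendre_1 by simp
  next
    case False
    then obtain q where q: "prime q" "q dvd n" using prime_factor_nat by blast
    then obtain l where l: "n = q * l" by (elim dvdE)
    then have "l < n" "l \<noteq> 0" using less.prems(1) prime_gt_1_nat[OF q(1)] by auto
    then have "Legendre (int l) (int p) = Legendre (int l) (int r)"
      using less l by (metis dvd_mult)
    then show ?thesis using less.prems(2)[OF q] p r by (simp add: l Legendre_mult)
  qed
qed

lemma Legendre_eq_1_obtain: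
  assumes "Legendre a p = 1"
  obtains y where "p dvd y\<^sup>2 - a"
  using assms by (auto simp: Legendre_def QuadRes_def cong_iff_dvd_diff split: if_splits)

lemma Legendre_mod_5: "Legendre 2 5 = -1" "Legendre 1 5 = 1" "Legendre 4 5 = 1"
proof -
  have 5: "prime (5::nat)" by simp
  have "[Legendre a (int 5) = a ^ 2] (mod int 5)" for a using euler_criterion[OF 5, of a] by simp
  then have "[a ^ 2 = s] (mod 5) \<Longrightarrow> [Legendre a 5 = s] (mod 5)" for a s
    using cong_trans by (metis of_nat_numeral)
  then have *: "[a ^ 2 = s] (mod 5) \<Longrightarrow> s \<in> {-1, 0, 1} \<Longrightarrow> Legendre a 5 = s" for a s
    using Legendre_eqI[of a 5 s] by simp
  show "Legendre 2 5 = -1" "Legendre 1 5 = 1" "Legendre 4 5 = 1"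
    by (rule *; simp add: cong_def)+
qed

section \<open>The ternary form\<close>

lemma ternary_rational_representation:
  fixes n :: nat
  assumes "n mod 5 = 1 \<or> n mod 5 = 4"
  shows "\<exists>A B C T :: int. T \<noteq> 0 \<and> int n * T\<^sup>2 = A\<^sup>2 + 5 * B\<^sup>2 + 10 * C\<^sup>2"
proof -
  define K where "K = squarefree_part n"
  define s where "s = square_part n"
  have n: "n = K * s\<^sup>2" unfolding K_def s_def by (rule squarefree_decompose)
  have sqf: "squarefree K" and "K \<noteq> 0" by (auto simp: K_def)
  \<comment> \<open>Here s is prime to 5, so its square is 1 or 4 modulo 5 and the condition passes
    from n to K.\<close>
  have K5: "K mod 5 = 1 \<or> K mod 5 = 4"
  proof -
    have "n mod 5 = (K mod 5) * ((s mod 5)\<^sup>2 mod 5) mod 5" by (simp add: n mod_simps)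
    moreover have "s mod 5 \<in> {0, 1, 2, 3, 4}" "K mod 5 \<in> {0, 1, 2, 3, 4}" by auto
    ultimately show ?thesis using assms by (elim insertE emptyE; simp)
  qed
  have p5: "prime (5::nat)" by simp
  have not5: "\<not> 5 dvd K" using K5 by (auto simp: dvd_eq_mod_eq_0)
  define Q where "Q = {q \<in> prime_factors K. q \<noteq> 2}"
  have Q: "prime q" "2 < q" "q dvd K" "q \<noteq> 5" if "q \<in> Q" for q
    using that not5 prime_ge_2_nat[of q] by (auto simp: Q_def in_prime_factors_iff le_less)
  have not_dvd_5: "\<not> int q dvd 5" if "q \<in> Q" for q
  proof
    assume "int q dvd 5"
    then have "q dvd 5" by presburger
    then show False using Q[OF that] p5 primes_dvd_imp_eq by blast
  qed
  have "\<exists>m. prime m \<and> m mod 8 = 3 \<and> (\<forall>q\<in>Q. Legendre (int m) (int q) = Legendre (-5) (int q))"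
  proof (rule exists_prime_with_residue_symbols)
    show "finite Q" by (simp add: Q_def)
    show "prime q \<and> 2 < q" if "q \<in> Q" for q using Q[OF that] by blast
    show "Legendre (-5) (int q) \<in> {-1, 1}" if "q \<in> Q" for q
      using not_dvd_5[OF that] by (intro Legendre_values) simp
  qed
  then obtain m where m: "prime m" "m mod 8 = 3"
    and mQ: "\<And>q. q \<in> Q \<Longrightarrow> Legendre (int m) (int q) = Legendre (-5) (int q)" by blast
  have m2: "2 < m" using m(2) mod_less_eq_dividend[of m 8] by linarith
  have "odd m" using m(1) m2 prime_odd_nat by blast
  have odd_half: "odd ((m - 1) div 2)"
  proof -
    have "m = 8 * (m div 8) + 3" using m(2) by (metis div_mult_mod_eq mult.commute)
    then have "(m - 1) div 2 = 4 * (m div 8) + 1" by linarith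
    then show ?thesis by simp
  qed
  have "m \<noteq> 5" using m(2) by auto
  have "\<not> m dvd K"
  proof
    assume "m dvd K"
    then have "m \<in> Q" using m m2 \<open>K \<noteq> 0\<close> by (auto simp: Q_def in_prime_factors_iff)
    moreover have "Legendre (int m) (int m) = 0" by (simp add: Legendre_def cong_def)
    ultimately show False using mQ[of m] not_dvd_5[of m] by (simp add: Legendre_def cong_0_iff split: if_splits)
  qed
  have "Legendre (int K) (int m) = Legendre (int K) (int 5)"
  proof (rule Legendre_eq_if_prime_factors[OF m(1) m2 p5 _ \<open>K \<noteq> 0\<close>])
    fix q assume q: "prime q" "q dvd K"
    show "Legendre (int q) (int m) = Legendre (int q) (int 5)"
    proof (cases "q = 2")
      case True
      then show ?thesis using Legendre_2_mod_8_eq_3[OF m] Legendre_mod_5(1) by simp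
    next
      case False
      then have "q \<in> Q" using q \<open>K \<noteq> 0\<close> by (auto simp: Q_def in_prime_factors_iff)
      note q' = Q[OF this]
      have "q \<noteq> m" using q \<open>\<not> m dvd K\<close> by auto
      \<comment> \<open>As (m - 1)/2 is odd, the sign in the reciprocity law for q and m is (-1/q);
        it cancels the (-1/q) in (m/q) = (-1/q)(5/q), and for q and 5 there is no sign.\<close>
      have "(-1 :: int) ^ ((q - 1) div 2 * ((m - 1) div 2)) = Legendre (-1) (int q)"
        unfolding Legendre_minus_1[OF q'(1,2)] using odd_half by (subst mult.commute, subst power_mult) simp
      then have "Legendre (int q) (int m) * Legendre (int m) (int q) = Legendre (-1) (int q)"
        using Quadratic_Reciprocity[of q m] q' m m2 \<open>q \<noteq> m\<close> by simp
      moreover have "Legendre (int m) (int q) = Legendre (-1) (int q) * Legendre 5 (int q)"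
        using mQ[OF \<open>q \<in> Q\<close>] Legendre_mult[OF q'(1,2), of "-1" 5] by simp
      moreover have "Legendre (int q) (int 5) * Legendre 5 (int q) = 1"
        using Quadratic_Reciprocity[of q 5] q' p5 by simp
      moreover have "Legendre (-1) (int q) \<in> {-1, 1}"
        using q' by (intro Legendre_values) auto
      ultimately show ?thesis by (auto simp: zmult_eq_1_iff)
    qed
  qed simp
  also have "\<dots> = 1"
  proof -
    have "int K mod 5 = 1 \<or> int K mod 5 = 4" using K5 by presburger
    then show ?thesis using Legendre_mod[of "int K" 5] Legendre_mod_5 by auto
  qed
  finally obtain v1 where v1: "int m dvd v1\<^sup>2 - int K" by (rule Legendre_eq_1_obtain)
  obtain v2 where v2: "5 dvd v2\<^sup>2 - int K"
  proof (cases "K mod 5 = 1")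
    case True
    then have "5 dvd 1\<^sup>2 - int K" by simp presburger
    then show ?thesis by (rule that)
  next
    case False
    then have "K mod 5 = 4" using K5 by simp
    then have "5 dvd 2\<^sup>2 - int K" by simp presburger
    then show ?thesis by (rule that)
  qed
  have cop5m: "coprime 5 (int m)"
    using primes_coprime[OF p5 m(1)] \<open>m \<noteq> 5\<close> by (metis coprime_int_iff of_nat_numeral)
  obtain v where v: "[v = v2] (mod 5)" "[v = v1] (mod int m)"
    using binary_chinese_remainder_int[OF cop5m] by blast
  have "[v\<^sup>2 - int K = v2\<^sup>2 - int K] (mod 5)" "[v\<^sup>2 - int K = v1\<^sup>2 - int K] (mod int m)"
    using v by (auto intro: cong_diff cong_pow)
  then have "5 dvd v\<^sup>2 - int K" "int m dvd v\<^sup>2 - int K" using v1 v2 by (auto simp: cong_dvd_iff)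
  then have v_dvd: "5 * int m dvd v\<^sup>2 - int K" using cop5m by (intro divides_mult)
  have "\<exists>u. int K dvd u\<^sup>2 + 5 * int m"
  proof (rule squarefree_sqrt_mod[OF sqf])
    fix q assume q: "prime q" "q dvd K"
    show "\<exists>u. int q dvd u\<^sup>2 + 5 * int m"
    proof (cases "q = 2")
      case True
      have "int 2 dvd 1\<^sup>2 + 5 * int m" using \<open>odd m\<close> by simp
      then show ?thesis using True by blast
    next
      case False
      then have "q \<in> Q" using q \<open>K \<noteq> 0\<close> by (auto simp: Q_def in_prime_factors_iff)
      note q' = Q[OF this]
      have "Legendre (-5 * int m) (int q) = (Legendre (-5) (int q))\<^sup>2"
        unfolding Legendre_mult[OF q'(1,2)] using mQ[OF \<open>q \<in> Q\<close>] by (simp add: power2_eq_square)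
      also have "\<dots> = 1"
        using Legendre_values[of "int q" "-5"] not_dvd_5[OF \<open>q \<in> Q\<close>] by auto
      finally obtain y where "int q dvd y\<^sup>2 - (-5 * int m)" by (rule Legendre_eq_1_obtain)
      then show ?thesis by auto
    qed
  qed
  then obtain u where u: "int K dvd u\<^sup>2 + 5 * int m" by blast
  have "\<exists>A E t. t \<noteq> 0 \<and> int K * t\<^sup>2 = A\<^sup>2 + 5 * int m * E\<^sup>2"
  proof (rule conic_solvable[OF _ _ _ _ u v_dvd])
    have "coprime m K" using m(1) \<open>\<not> m dvd K\<close> by (rule prime_imp_coprime)
    moreover have "coprime 5 K" using p5 not5 by (rule prime_imp_coprime)
    ultimately have "coprime K (5 * m)" by (simp add: coprime_commute)
    then show "coprime (int K) (5 * int m)" by (metis coprime_int_iff of_nat_mult of_nat_numeral)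
    show "\<nexists>s. 5 * int m = s\<^sup>2"
    proof
      assume "\<exists>s. 5 * int m = s\<^sup>2"
      then obtain s where s: "5 * int m = s\<^sup>2" by blast
      then have "5 dvd s\<^sup>2" by (metis dvd_triv_left)
      then have "5 dvd s" using prime_dvd_power[of "5 :: int"] by simp
      then obtain r where "s = 5 * r" by (elim dvdE)
      then have "int m = 5 * r\<^sup>2" using s by (simp add: power_mult_distrib)
      then have "5 dvd m" by presburger
      then show False using primes_dvd_imp_eq[OF p5 m(1)] \<open>m \<noteq> 5\<close> by simp
    qed
  qed (use \<open>K \<noteq> 0\<close> m2 in auto)
  then obtain A E t where AEt: "t \<noteq> 0" "int K * t\<^sup>2 = A\<^sup>2 + 5 * int m * E\<^sup>2" by blast
  \<comment> \<open>-1 and 2 are both non-residues modulo m.\<close>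
  have "Legendre (-2) (int m) = 1"
    using Legendre_mult[OF m(1) m2, of "-1" 2] Legendre_minus_1[OF m(1) m2] Legendre_2_mod_8_eq_3[OF m]
      odd_half by simp
  then obtain w where "int m dvd w\<^sup>2 - (-2)" by (rule Legendre_eq_1_obtain)
  then have w: "int m dvd w\<^sup>2 + 2" by simp
  have "\<exists>A E t. t \<noteq> 0 \<and> int m * t\<^sup>2 = A\<^sup>2 + 2 * E\<^sup>2"
  proof (rule conic_solvable[OF _ _ _ _ w])
    show "2 dvd 1\<^sup>2 - int m" using \<open>odd m\<close> by simp
    show "coprime (int m) 2" using \<open>odd m\<close> by (simp add: coprime_right_2_iff_odd)
    show "\<nexists>s :: int. 2 = s\<^sup>2"
    proof
      assume "\<exists>s :: int. 2 = s\<^sup>2"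
      then obtain s :: int where s: "2 = s\<^sup>2" by blast
      then have "even (s\<^sup>2)" by simp
      then obtain r where "s = 2 * r" by (auto elim: evenE)
      with s show False by (simp add: power_mult_distrib) presburger
    qed
  qed (use m2 in auto)
  then obtain B C \<tau> where BC: "\<tau> \<noteq> 0" "int m * \<tau>\<^sup>2 = B\<^sup>2 + 2 * C\<^sup>2" by blast
  have "int n * (t * \<tau>)\<^sup>2 = (int s)\<^sup>2 * (int K * t\<^sup>2) * \<tau>\<^sup>2" by (simp add: n power_mult_distrib mult_ac)
  also have "\<dots> = (int s)\<^sup>2 * (A\<^sup>2 * \<tau>\<^sup>2 + 5 * E\<^sup>2 * (int m * \<tau>\<^sup>2))"
    unfolding AEt(2) by (simp add: algebra_simps)
  also have "\<dots> = (int s * A * \<tau>)\<^sup>2 + 5 * (int s * E * B)\<^sup>2 + 10 * (int s * E * C)\<^sup>2"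
    unfolding BC(2) by (simp add: algebra_simps power_mult_distrib)
  finally have "int n * (t * \<tau>)\<^sup>2 = (int s * A * \<tau>)\<^sup>2 + 5 * (int s * E * B)\<^sup>2 + 10 * (int s * E * C)\<^sup>2" .
  moreover have "t * \<tau> \<noteq> 0" using AEt BC by simp
  ultimately show ?thesis by blast
qed

text \<open>Half of 5 (p^2 + q^2 + r^2) - (p + q + r)^2, which is what 5a - b^2 becomes once w is
  subtracted from x, y and z.\<close>

definition ternary :: "int \<Rightarrow> int \<Rightarrow> int \<Rightarrow> int" where
  "ternary p q r = 2 * (p\<^sup>2 + q\<^sup>2 + r\<^sup>2) - (p * q + q * r + r * p)"

lemma ternary_sum_of_squares:
  "2 * ternary p q r = (p - q)\<^sup>2 + (q - r)\<^sup>2 + (r - p)\<^sup>2 + 2 * (p\<^sup>2 + q\<^sup>2 + r\<^sup>2)"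
  by (simp add: ternary_def power2_eq_square algebra_simps)

definition ternary_polar :: "int \<Rightarrow> int \<Rightarrow> int \<Rightarrow> int \<Rightarrow> int \<Rightarrow> int \<Rightarrow> int" where
  "ternary_polar p q r x y z = 4 * (p * x + q * y + r * z) - p * (y + z) - q * (x + z) - r * (x + y)"

lemma ternary_combination:
  "ternary (s * x + h * u) (s * y + h * v) (s * z + h * w)
     = s\<^sup>2 * ternary x y z + s * h * ternary_polar u v w x y z + h\<^sup>2 * ternary u v w"
  by (simp add: ternary_def ternary_polar_def power2_eq_square algebra_simps)

lemma ternary_polar_diff:
  "ternary_polar (p - t * x) (q - t * y) (r - t * z) x y z
     = ternary_polar p q r x y z - 2 * t * ternary x y z"
  by (simp add: ternary_def ternary_polar_def power2_eq_square algebra_simps)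

lemma ternary_nonneg: "0 \<le> ternary p q r"
proof -
  have "0 \<le> 2 * ternary p q r" unfolding ternary_sum_of_squares by (intro add_nonneg_nonneg) auto
  then show ?thesis by simp
qed

lemma ternary_eq_0:
  assumes "ternary p q r = 0"
  shows "p = 0 \<and> q = 0 \<and> r = 0"
proof -
  define S U where "S = (p - q)\<^sup>2 + (q - r)\<^sup>2 + (r - p)\<^sup>2" and "U = p\<^sup>2 + q\<^sup>2 + r\<^sup>2"
  have "S \<ge> 0" "U \<ge> 0" "S + 2 * U = 0"
    using ternary_sum_of_squares[of p q r] assms by (auto simp: S_def U_def)
  then have "(p\<^sup>2 + q\<^sup>2) + r\<^sup>2 = 0" unfolding U_def[symmetric] by linarith
  then have "p\<^sup>2 + q\<^sup>2 = 0" "r\<^sup>2 = 0"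
    by (subst (asm) add_nonneg_eq_0_iff; simp)+
  then show ?thesis by (simp add: sum_power2_eq_zero_iff)
qed

text \<open>The simplex with vertices \<open>0\<close>, \<open>(t,0,0)\<close>, \<open>(t,t,0)\<close>, \<open>(t,t,t)\<close> has its circumcentre at
  \<open>(7,5,3)t/10\<close> and squared circumradius \<open>19 t\<^sup>2/20\<close>. Averaging the squared distances to the vertices
  with the barycentric coordinates \<open>t - a\<close>, \<open>a - b\<close>, \<open>b - c\<close>, \<open>c\<close> shows that some vertex is within
  that radius. That the constant is below 1 is what makes the Aubry--Davenport--Cassels
  descent from rational to integral representations work.\<close>

lemma ternary_cover_ordered:
  assumes "0 \<le> c" "c \<le> b" "b \<le> a" "a \<le> t" "0 < t"
  shows "\<exists>i j k. 20 * ternary (a - i * t) (b - j * t) (c - k * t) \<le> 19 * t\<^sup>2"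
proof (rule ccontr)
  assume "\<not> ?thesis"
  then have *: "19 * t\<^sup>2 < 20 * ternary (a - i * t) (b - j * t) (c - k * t)" for i j k
    by (meson not_le)
  let ?f = "\<lambda>i j k. 20 * ternary (a - i * t) (b - j * t) (c - k * t) - 19 * t\<^sup>2"
  \<comment> \<open>The averaged squared distance to the vertices is the squared circumradius minus
    the squared distance from the circumcentre; the factors 5 and 10 clear denominators.\<close>
  have "5 * ((t - a) * ?f 0 0 0 + (a - b) * ?f 1 0 0 + (b - c) * ?f 1 1 0 + c * ?f 1 1 1)
      = - (t * ternary (10 * a - 7 * t) (10 * b - 5 * t) (10 * c - 3 * t))"
    by (simp add: ternary_def power2_eq_square algebra_simps)
  moreover have "0 \<le> t * ternary (10 * a - 7 * t) (10 * b - 5 * t) (10 * c - 3 * t)"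
    using assms ternary_nonneg by simp
  \<comment> \<open>By integrality each \<open>?f\<close> is at least 1, and the nonnegative weights
    add up to t > 0, so the average would be positive.\<close>
  moreover have "0 \<le> (t - a) * (?f 0 0 0 - 1)" "0 \<le> (a - b) * (?f 1 0 0 - 1)" "0 \<le> (b - c) * (?f 1 1 0 - 1)"
      "0 \<le> c * (?f 1 1 1 - 1)"
    using assms *[of 0 0 0] *[of 1 0 0] *[of 1 1 0] *[of 1 1 1] by (auto intro!: mult_nonneg_nonneg)
  ultimately show False using assms by (simp add: right_diff_distrib)
qed

lemma ternary_cover:
  assumes "0 \<le> a" "a \<le> t" "0 \<le> b" "b \<le> t" "0 \<le> c" "c \<le> t" "0 < t"
  shows "\<exists>i j k. 20 * ternary (a - i * t) (b - j * t) (c - k * t) \<le> 19 * t\<^sup>2"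
proof -
  have sym: "ternary p q r = ternary q p r" "ternary p q r = ternary p r q" for p q r
    by (simp_all add: ternary_def algebra_simps)
  consider "c \<le> b \<and> b \<le> a" | "b \<le> c \<and> c \<le> a" | "c \<le> a \<and> a \<le> b" | "a \<le> c \<and> c \<le> b"
    | "b \<le> a \<and> a \<le> c" | "a \<le> b \<and> b \<le> c" by linarith
  then show ?thesis
  proof cases
    case 1 then show ?thesis using ternary_cover_ordered[of c b a t] assms by blast
  next
    case 2 then show ?thesis using ternary_cover_ordered[of b c a t] assms sym by metis
  next
    case 3 then show ?thesis using ternary_cover_ordered[of c a b t] assms sym by metis
  next
    case 4 then show ?thesis using ternary_cover_ordered[of a c b t] assms sym by metis
  next
    case 5 then show ?thesis using ternary_cover_ordered[of b a c t] assms sym by metis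
  next
    case 6 then show ?thesis using ternary_cover_ordered[of a b c t] assms sym by metis
  qed
qed

section \<open>Descent from rational to integral representations\<close>

lemma ternary_descent:
  assumes "t > 0" "ternary p q r = n * t\<^sup>2"
  shows "\<exists>p q r. ternary p q r = n"
  using assms
proof (induction "nat t" arbitrary: t p q r rule: less_induct)
  case less
  have "\<exists>i j k. 20 * ternary (p mod t - i * t) (q mod t - j * t) (r mod t - k * t) \<le> 19 * t\<^sup>2"
    using less.prems(1) by (intro ternary_cover) (auto intro: less_imp_le)
  then obtain i j k where ijk: "20 * ternary (p mod t - i * t) (q mod t - j * t) (r mod t - k * t) \<le> 19 * t\<^sup>2"
    by blast
  define x y z where "x = p div t + i" and "y = q div t + j" and "z = r div t + k"
  have eqs: "p mod t - i * t = p - t * x" "q mod t - j * t = q - t * y" "r mod t - k * t = r - t * z"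
    by (simp_all add: x_def y_def z_def algebra_simps minus_mult_div_eq_mod[symmetric])
  define F where "F = ternary x y z"
  \<comment> \<open>The line through the rational point \<open>(p,q,r)/t\<close> and the nearby lattice point \<open>(x,y,z)\<close> meets
    the quadric in a second point, whose denominator divides \<open>s < t\<close>.\<close>
  define s where "s = n * t - ternary_polar p q r x y z + t * F"
  have s: "ternary (p - t * x) (q - t * y) (r - t * z) = t * s"
  proof -
    have "ternary (p - t * x) (q - t * y) (r - t * z) = ternary p q r
       - t * ternary_polar p q r x y z + t\<^sup>2 * F"
      using ternary_combination[of "- t" x 1 p y q z r] by (simp add: F_def algebra_simps)
    then show ?thesis by (simp add: s_def less.prems(2) power2_eq_square algebra_simps)
  qed
  have "20 * (t * s) \<le> 19 * t\<^sup>2" using ijk unfolding eqs s .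
  then have "t * (20 * s) \<le> t * (19 * t)" by (simp add: power2_eq_square algebra_simps)
  then have "20 * s \<le> 19 * t" using less.prems(1) by (simp only: mult_le_cancel_left_pos)
  then have "s < t" using less.prems(1) by linarith
  have "0 \<le> t * s" using ternary_nonneg s by metis
  then have "0 \<le> s" using less.prems(1) by (simp add: zero_le_mult_iff)
  show ?case
  proof (cases "s = 0")
    case True
    then have "ternary (p - t * x) (q - t * y) (r - t * z) = 0" by (simp add: s)
    from ternary_eq_0[OF this] have "p = t * x" "q = t * y" "r = t * z" by simp_all
    then have "ternary p q r = F * t\<^sup>2" by (simp add: ternary_def F_def power2_eq_square algebra_simps)
    then show ?thesis using less.prems F_def by auto
  next
    case False
    \<comment> \<open>On the line (x,y,z) + c (p - t x, q - t y, r - t z) the two solutions c have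
      product (F - n)/(t s) and one of them is 1/t, so the other is (F - n)/s. The point is scaled
      by s.\<close>
    have "ternary (s * x + (F - n) * (p - t * x)) (s * y + (F - n) * (q - t * y)) (s * z + (F - n) * (r - t * z))
        = s\<^sup>2 * F + s * (F - n) * (ternary_polar p q r x y z - 2 * t * F)
        + (F - n)\<^sup>2 * ternary (p - t * x) (q - t * y) (r - t * z)"
      unfolding ternary_combination ternary_polar_diff F_def by simp
    also have "ternary_polar p q r x y z = n * t + t * F - s"
      by (simp add: s_def)
    also have "s\<^sup>2 * F + s * (F - n) * (n * t + t * F - s - 2 * t * F)
        + (F - n)\<^sup>2 * ternary (p - t * x) (q - t * y) (r - t * z) = n * s\<^sup>2"
      unfolding s by (simp add: power2_eq_square algebra_simps)
    finally show ?thesis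
      using False \<open>0 \<le> s\<close> \<open>s < t\<close> by (intro less.hyps[of s]) auto
  qed
qed

lemma ternary_represents:
  fixes n :: int
  assumes "0 < n" "(2 * n) mod 5 = 1 \<or> (2 * n) mod 5 = 4"
  shows "\<exists>p q r. ternary p q r = n"
proof -
  have "nat (2 * n) mod 5 = 1 \<or> nat (2 * n) mod 5 = 4" 
  proof -
    have "int (nat (2 * n) mod 5) = (2 * n) mod 5" using assms(1) by (simp add: zmod_int)
    then show ?thesis using assms(2) by linarith
  qed
  from ternary_rational_representation[OF this] assms(1) obtain A B C T
    where T: "T \<noteq> 0" "2 * n * T\<^sup>2 = A\<^sup>2 + 5 * B\<^sup>2 + 10 * C\<^sup>2" by auto
  \<comment> \<open>The vectors (1,0,0), (1,2,2), (0,2,-2) are orthogonal for the form, with values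
    2, 10 and 20.\<close>
  have "ternary (A + B) (2 * (B + C)) (2 * (B - C)) = 2 * (A\<^sup>2 + 5 * B\<^sup>2 + 10 * C\<^sup>2)"
    by (simp add: ternary_def power2_eq_square algebra_simps)
  also have "\<dots> = n * (2 * \<bar>T\<bar>)\<^sup>2" by (simp add: T(2)[symmetric] power_mult_distrib)
  finally show ?thesis using T by (intro ternary_descent[of "2 * \<bar>T\<bar>"]) auto
qed

section \<open>Cauchy's lemma: prescribed sum and sum of squares\<close>

lemma sum_and_sum_of_squares:
  fixes a b :: int
  assumes b: "0 \<le> b" "\<not> 5 dvd b" and par: "even (a + b)" and pos: "b\<^sup>2 < 5 * a"
    and upper: "4 * a < b\<^sup>2 + 2 * b + 5"
  shows "\<exists>x\<ge>0. \<exists>y\<ge>0. \<exists>z\<ge>0. \<exists>w\<ge>0. x + y + z + 2 * w = b \<and> x\<^sup>2 + y\<^sup>2 + z\<^sup>2 + 2 * w\<^sup>2 = a"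
proof -
  have "even (5 * a - b\<^sup>2)" using par by auto
  then obtain n where n: "5 * a - b\<^sup>2 = 2 * n" by (elim evenE)
  have "b mod 5 \<in> {1, 2, 3, 4}" using b(2) by simp presburger
  moreover have "[5 * a - b\<^sup>2 = 0 - (b mod 5)\<^sup>2] (mod 5)"
    by (intro cong_diff cong_pow) (auto simp: cong_def)
  then have "(2 * n) mod 5 = (- ((b mod 5)\<^sup>2)) mod 5" by (simp add: n cong_def)
  ultimately have "(2 * n) mod 5 = 1 \<or> (2 * n) mod 5 = 4" by auto
  then obtain p q r where pqr: "ternary p q r = n" using ternary_represents[of n] n pos by auto
  define \<sigma> where "\<sigma> = p + q + r"
  have \<sigma>: "5 * a - b\<^sup>2 = 5 * (p\<^sup>2 + q\<^sup>2 + r\<^sup>2) - \<sigma>\<^sup>2"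
    unfolding n pqr[symmetric] by (simp add: ternary_def \<sigma>_def power2_eq_square algebra_simps)
  then have "(b - \<sigma>) * (b + \<sigma>) = 5 * (a - (p\<^sup>2 + q\<^sup>2 + r\<^sup>2))" by (simp add: power2_eq_square algebra_simps)
  then have "5 dvd (b - \<sigma>) * (b + \<sigma>)" by simp
  then have "5 dvd b - \<sigma> \<or> 5 dvd b + \<sigma>" by (subst (asm) prime_dvd_mult_iff) auto
  \<comment> \<open>The form is even, so (p, q, r) may change sign; one of the two signs makes w
    integral.\<close>
  then obtain e where e: "e = 1 \<or> e = -1" "5 dvd b - e * \<sigma>" by (metis diff_minus_eq_add minus_mult_left mult_1)
  then obtain w where w: "b - e * \<sigma> = 5 * w" by (elim dvdE)
  define x y z where "x = w + e * p" and "y = w + e * q" and "z = w + e * r"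
  have sum: "x + y + z + 2 * w = b"
    using w by (simp add: x_def y_def z_def \<sigma>_def algebra_simps)
  have "5 * (x\<^sup>2 + y\<^sup>2 + z\<^sup>2 + 2 * w\<^sup>2) = 5 * (p\<^sup>2 + q\<^sup>2 + r\<^sup>2) - \<sigma>\<^sup>2 + (e * \<sigma> + 5 * w)\<^sup>2"
    using e(1) unfolding x_def y_def z_def \<sigma>_def
    by (elim disjE) (simp_all add: power2_eq_square algebra_simps)
  also have "e * \<sigma> + 5 * w = b" using w by simp
  finally have sq: "x\<^sup>2 + y\<^sup>2 + z\<^sup>2 + 2 * w\<^sup>2 = a" using \<sigma> by simp
  \<comment> \<open>Cauchy-Schwarz on y, z, w, w gives 5 x^2 - 2 b x \<le> 4a - b^2. For x \<le> -1
    the left side is at least 2b + 5, which is exactly what \<open>upper\<close> excludes.\<close>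
  have nonneg: "0 \<le> x" if "x + y + z + 2 * w = b" "x\<^sup>2 + y\<^sup>2 + z\<^sup>2 + 2 * w\<^sup>2 = a" for x y z
  proof (rule ccontr)
    assume "\<not> 0 \<le> x"
    have "0 \<le> (y - z)\<^sup>2 + 2 * (y - w)\<^sup>2 + 2 * (z - w)\<^sup>2" by simp
    also have "\<dots> = 4 * (y\<^sup>2 + z\<^sup>2 + 2 * w\<^sup>2) - (y + z + 2 * w)\<^sup>2"
      by (simp add: power2_eq_square algebra_simps)
    also have "y\<^sup>2 + z\<^sup>2 + 2 * w\<^sup>2 = a - x\<^sup>2" using that(2) by simp
    also have "y + z + 2 * w = b - x" using that(1) by simp
    also have "4 * (a - x\<^sup>2) - (b - x)\<^sup>2 = 4 * a - b\<^sup>2 - 5 * (x * x) + 2 * (b * x)" by (simp add: power2_eq_square algebra_simps)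
    finally have "5 * (x * x) - 2 * (b * x) < 2 * b + 5" using upper by linarith
    moreover have "1 \<le> x * x" using \<open>\<not> 0 \<le> x\<close> mult_mono[of 1 "-x" 1 "-x"] by simp
    moreover have "b * x \<le> b * (-1)" using \<open>\<not> 0 \<le> x\<close> b by (intro mult_left_mono) auto
    ultimately show False by linarith
  qed
  \<comment> \<open>The same with Cauchy-Schwarz on x, y, z: a negative w would need 3a \<ge> b^2 +
    4b + 10.\<close>
  have "0 \<le> w"
  proof (rule ccontr)
    assume "\<not> 0 \<le> w"
    have "0 \<le> (x - y)\<^sup>2 + (y - z)\<^sup>2 + (z - x)\<^sup>2" by simp
    also have "\<dots> = 3 * (x\<^sup>2 + y\<^sup>2 + z\<^sup>2) - (x + y + z)\<^sup>2" by (simp add: power2_eq_square algebra_simps)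
    also have "x + y + z = b - 2 * w" using sum by simp
    also have "x\<^sup>2 + y\<^sup>2 + z\<^sup>2 = a - 2 * w\<^sup>2" using sq by simp
    also have "3 * (a - 2 * w\<^sup>2) - (b - 2 * w)\<^sup>2 = 3 * a - b\<^sup>2 - 10 * (w * w) + 4 * (b * w)"
      by (simp add: power2_eq_square algebra_simps)
    finally have "b\<^sup>2 + 10 * (w * w) - 4 * (b * w) \<le> 3 * a" by simp
    moreover have "1 \<le> w * w" using \<open>\<not> 0 \<le> w\<close> mult_mono[of 1 "-w" 1 "-w"] by simp
    moreover have "b * w \<le> b * (-1)" using \<open>\<not> 0 \<le> w\<close> b by (intro mult_left_mono) auto
    ultimately show False using upper b zero_le_power2[of b] by linarith
  qed
  moreover have "0 \<le> x" by (rule nonneg[OF sum sq])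
  moreover have "0 \<le> y" by (rule nonneg[of y x z]) (use sum sq in simp_all)
  moreover have "0 \<le> z" by (rule nonneg[of z x y]) (use sum sq in simp_all)
  ultimately show ?thesis using sum sq by blast
qed

section \<open>Representation of large and small numbers\<close>

text \<open>Eight consecutive integers contain two members of the class that differ by 4, and 5
  cannot divide both.\<close>

lemma exists_residue_not_dvd_5:
  fixes c r :: int
  shows "\<exists>b. c \<le> b \<and> b \<le> c + 7 \<and> 4 dvd b - r \<and> \<not> 5 dvd b"
proof -
  define b where "b = c + (r - c) mod 4"
  have b: "c \<le> b" "b \<le> c + 3" using pos_mod_bound[of 4 "r - c"] by (simp_all add: b_def)
  have "b - r = - ((r - c) - (r - c) mod 4)" by (simp add: b_def)
  then have b4: "4 dvd b - r" by (metis dvd_minus_iff dvd_minus_mod)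
  show ?thesis
  proof (cases "5 dvd b")
    case False
    with b b4 show ?thesis by (intro exI[of _ b]) auto
  next
    case True
    then have "\<not> 5 dvd b + 4" by presburger
    moreover have "4 dvd b + 4 - r" using b4 by presburger
    ultimately show ?thesis using b by (intro exI[of _ "b + 4"]) auto
  qed
qed

lemma large_minus:
  fixes n :: int
  assumes "1682 \<le> n"
  shows "\<exists>w\<ge>0. \<exists>x\<ge>0. \<exists>y\<ge>0. \<exists>z\<ge>0.
    n = 2 * (w * (2 * w + -1)) + x * (2 * x + -1) + y * (2 * y + -1) + z * (2 * z + -1)"
proof -
  obtain s where s: "s \<ge> 0" "s\<^sup>2 \<le> 2 * n" "2 * n < (s + 1)\<^sup>2" using int_sqrt_bounds[of "2 * n"] assms by auto
  obtain b where b: "s + 1 \<le> b" "b \<le> s + 8" "4 dvd b - n" "\<not> 5 dvd b"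
    using exists_residue_not_dvd_5[of "s + 1" n] by auto
  have "58 \<le> s"
  proof (rule ccontr)
    assume "\<not> 58 \<le> s"
    then have "(s + 1)\<^sup>2 \<le> 58\<^sup>2" using s by (intro power_mono) auto
    then show False using s assms by simp
  qed
  obtain k where k: "b - n = 4 * k" using b(3) by (elim dvdE)
  define a where "a = b - 2 * k"
  have n: "n = 2 * a - b" using k by (simp add: a_def)
  \<comment> \<open>As 4a = 2n + 2b, the upper condition is 2n < b^2 + 5, so the window for b starts
    at s + 1.\<close>
  have "(s + 1)\<^sup>2 \<le> b\<^sup>2" using s b by (intro power_mono) auto
  then have upper: "4 * a < b\<^sup>2 + 2 * b + 5" using s(3) n by linarith
  \<comment> \<open>b^2 < 5a means 2 b^2 - 5 b < 5n. The product replaces b by its largest value s +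
    8, and s^2 - 54 s - 176 > 0 remains; this holds from s = 58, whence 1682 = 58^2/2.\<close>
  have "0 \<le> (s + 8 - b) * (2 * (s + 8 + b) - 5)" using s b by (intro mult_nonneg_nonneg) auto
  moreover have "0 \<le> (s - 58) * (s + 4)" using \<open>58 \<le> s\<close> by (intro mult_nonneg_nonneg) auto
  ultimately have "b\<^sup>2 < 5 * a" using s(2) n by (simp add: power2_eq_square algebra_simps)
  moreover have "even (a + b)" by (simp add: a_def)
  ultimately obtain x y z w where "0 \<le> x" "0 \<le> y" "0 \<le> z" "0 \<le> w"
    "x + y + z + 2 * w = b" "x\<^sup>2 + y\<^sup>2 + z\<^sup>2 + 2 * w\<^sup>2 = a"
    using sum_and_sum_of_squares[of b a] upper b s by auto
  moreover from this have "n = 2 * (w * (2 * w + -1)) + x * (2 * x + -1) + y * (2 * y + -1) + z * (2 * z + -1)"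
    unfolding n by (simp add: power2_eq_square algebra_simps)
  ultimately show ?thesis by blast
qed

lemma large_plus:
  fixes n :: int
  assumes "1922 \<le> n"
  shows "\<exists>w\<ge>0. \<exists>x\<ge>0. \<exists>y\<ge>0. \<exists>z\<ge>0.
    n = 2 * (w * (2 * w + 1)) + x * (2 * x + 1) + y * (2 * y + 1) + z * (2 * z + 1)"
proof -
  obtain s where s: "s \<ge> 0" "s\<^sup>2 \<le> 2 * n" "2 * n < (s + 1)\<^sup>2" using int_sqrt_bounds[of "2 * n"] assms by auto
  obtain b where b: "s - 1 \<le> b" "b \<le> s + 6" "4 dvd b - (- n)" "\<not> 5 dvd b"
    using exists_residue_not_dvd_5[of "s - 1" "- n"] by auto
  have "62 \<le> s"
  proof (rule ccontr)
    assume "\<not> 62 \<le> s"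
    then have "(s + 1)\<^sup>2 \<le> 62\<^sup>2" using s by (intro power_mono) auto
    then show False using s assms by simp
  qed
  obtain k where k: "b + n = 4 * k" using b(3) by (auto elim: dvdE)
  define a where "a = 2 * k - b"
  have n: "n = 2 * a + b" using k by (simp add: a_def)
  \<comment> \<open>Now 4a = 2n - 2b and the condition is 2n < (b + 2)^2 + 1, so the window starts
    at s - 1. At its end s + 6 the lower condition becomes s^2 - 58 s - 204 > 0, true from s = 62,
    and 1922 = 62^2/2.\<close>
  have "(s + 1)\<^sup>2 \<le> (b + 2)\<^sup>2" using s b by (intro power_mono) auto
  then have upper: "4 * a < b\<^sup>2 + 2 * b + 5" using s(3) n by (simp add: power2_eq_square algebra_simps)
  have "0 \<le> (s + 6 - b) * (2 * (s + 6 + b) + 5)" using \<open>62 \<le> s\<close> b by (intro mult_nonneg_nonneg) auto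
  moreover have "0 \<le> (s - 62) * (s + 4)" using \<open>62 \<le> s\<close> by (intro mult_nonneg_nonneg) auto
  ultimately have "b\<^sup>2 < 5 * a" using s(2) n by (simp add: power2_eq_square algebra_simps)
  moreover have "even (a + b)" by (simp add: a_def)
  ultimately obtain x y z w where "0 \<le> x" "0 \<le> y" "0 \<le> z" "0 \<le> w"
    "x + y + z + 2 * w = b" "x\<^sup>2 + y\<^sup>2 + z\<^sup>2 + 2 * w\<^sup>2 = a"
    using sum_and_sum_of_squares[of b a] upper b \<open>62 \<le> s\<close> by auto
  moreover from this have "n = 2 * (w * (2 * w + 1)) + x * (2 * x + 1) + y * (2 * y + 1) + z * (2 * z + 1)"
    unfolding n by (simp add: power2_eq_square algebra_simps)
  ultimately show ?thesis by blast
qed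

text \<open>Evaluation by \<open>code_simp\<close> only stops early at conditionals, so the searches below branch
  with \<open>if\<close> instead of using the Boolean connectives.\<close>

fun exists_in :: "('a \<Rightarrow> bool) \<Rightarrow> 'a list \<Rightarrow> bool" where
  "exists_in P [] = False"
| "exists_in P (x # xs) = (if P x then True else exists_in P xs)"

fun elem_sorted :: "int \<Rightarrow> int list \<Rightarrow> bool" where
  "elem_sorted a [] = False"
| "elem_sorted a (x # xs) = (if a < x then False else if a = x then True else elem_sorted a xs)"

text \<open>Hexagonal numbers for \<open>e = -1\<close>, second hexagonal numbers for
  \<open>e = 1\<close>.\<close>

definition hexagonals :: "int \<Rightarrow> int \<Rightarrow> int list" where
  "hexagonals e k = map (\<lambda>x. x * (2 * x + e)) [0..k]"

text \<open>The sums of three terms that represent the numbers up to a few hundred outside the list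
  \<open>gaps\<close> are tabulated first; every number of the range to be checked is then a fourth term
  plus a tabulated sum.\<close>

definition ternary_ok :: "int list \<Rightarrow> int list \<Rightarrow> int \<Rightarrow> bool" where
  "ternary_ok hs gaps B = list_all (\<lambda>r. if elem_sorted r gaps then True
     else exists_in (\<lambda>a. exists_in (\<lambda>b. elem_sorted (r - 2 * a - b) hs) hs) hs) [0..B]"

definition has_tabulated_rest :: "int list \<Rightarrow> int list \<Rightarrow> int \<Rightarrow> int list \<Rightarrow> int \<Rightarrow> bool" where
  "has_tabulated_rest hs gaps B ex n = (if elem_sorted n ex then True
     else exists_in (\<lambda>c. if n < c then False else if B < n - c then False
       else if elem_sorted (n - c) gaps then False else True) hs)"

definition quaternary_ok :: "int list \<Rightarrow> int list \<Rightarrow> int \<Rightarrow> int list \<Rightarrow> int \<Rightarrow> int \<Rightarrow> bool" where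
  "quaternary_ok hs gaps B ex m k = list_all (\<lambda>j. list_all (\<lambda>i.
     has_tabulated_rest hs gaps B ex (m + 50 * j + i)) [0..49]) [0..k]"

definition gaps_minus :: "int list" where
  "gaps_minus =
     [5, 10, 11, 20, 22, 25, 26, 35, 38, 39, 44, 49, 50, 52, 54, 61, 65, 70, 80, 82, 87, 88,
     89, 95, 98, 100, 110, 114, 115, 117, 125, 130, 140, 142, 143, 145, 152, 158, 164, 172,
     173, 174, 179, 185, 206, 214, 236, 245, 250, 257, 260, 266, 290, 292, 298, 305, 319, 320]"

definition gaps_plus :: "int list" where
  "gaps_plus =
     [1, 2, 4, 5, 7, 8, 11, 14, 15, 17, 18, 22, 25, 28, 29, 32, 34, 35, 38, 43, 47, 49, 50, 53,
     54, 60, 67, 68, 69, 70, 74, 79, 80, 83, 86, 89, 90, 95, 102, 104, 106, 109, 112, 117, 122,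
     124, 138, 140, 143, 151, 154, 155, 158, 164, 170, 173, 179, 184, 185, 190, 193, 196, 200,
     204, 206, 217, 222, 235, 238, 239, 242, 245, 248, 250, 254, 257, 258, 260, 277, 287, 290,
     299, 304, 319, 322, 326, 332, 333, 334, 338, 340, 365, 368, 383, 385, 390, 394, 404]"

text \<open>13 is the last index whose term does not exceed 343; likewise 14 for 419 in the
  companion lemma.\<close>

lemma ternary_ok_minus: "ternary_ok (hexagonals (-1) 13) gaps_minus 343"
  by code_simp

lemma ternary_ok_plus: "ternary_ok (hexagonals 1 14) gaps_plus 419"
  by code_simp

text \<open>34 blocks of 50 reach 1699, past the required 1681, and 29 is the last index with a term
  in that range. \<open>rev\<close> tries large terms first, which leave small remainders. In the
  companion lemma 37 blocks from 90 reach 1939.\<close>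

lemma quaternary_ok_minus:
  "quaternary_ok (rev (hexagonals (-1) 29)) gaps_minus 343 [11, 26, 50] 0 33"
  by code_simp

lemma quaternary_ok_plus:
  "quaternary_ok (rev (hexagonals 1 30)) gaps_plus 419 [] 90 36"
  by code_simp

lemma exists_in_iff: "exists_in P xs \<longleftrightarrow> (\<exists>x\<in>set xs. P x)"
  by (induction xs) auto

lemma elem_sortedD: "elem_sorted a xs \<Longrightarrow> a \<in> set xs"
  by (induction xs) (auto split: if_splits)

lemma quaternary_okD:
  assumes ter: "ternary_ok (hexagonals e k) gaps B"
    and qua: "quaternary_ok (rev (hexagonals e l)) gaps B ex m M"
    and n: "m \<le> n" "n < m + 50 * (M + 1)" "n \<notin> set ex"
  shows "\<exists>w\<ge>0. \<exists>x\<ge>0. \<exists>y\<ge>0. \<exists>z\<ge>0.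
    n = 2 * (w * (2 * w + e)) + x * (2 * x + e) + y * (2 * y + e) + z * (2 * z + e)"
proof -
  have hex: "\<exists>x\<ge>0. c = x * (2 * x + e)" if "c \<in> set (hexagonals e j)" for c j
    using that by (auto simp: hexagonals_def)
  have "\<not> elem_sorted n ex" using elem_sortedD n(3) by blast
  moreover have "has_tabulated_rest (rev (hexagonals e l)) gaps B ex n"
  proof -
    define j i where "j = (n - m) div 50" and "i = (n - m) mod 50"
    have "n = m + 50 * j + i" by (simp add: j_def i_def)
    moreover have "j \<in> set [0..M]" "i \<in> set [0..49]" using n by (auto simp: j_def i_def)
    ultimately show ?thesis using qua unfolding quaternary_ok_def list_all_iff by blast
  qed
  ultimately have "\<exists>c\<in>set (hexagonals e l). if n < c then False else if B < n - c then False
      else if elem_sorted (n - c) gaps then False else True"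
    by (simp only: has_tabulated_rest_def exists_in_iff set_rev if_False)
  then obtain c where c: "c \<in> set (hexagonals e l)" "c \<le> n" "n - c \<le> B" "\<not> elem_sorted (n - c) gaps"
    by (metis not_less)
  \<comment> \<open>The test on \<open>gaps\<close> that the remainder failed is literally the one
    in \<open>ternary_ok\<close>, so the table supplies its three terms.\<close>
  then obtain a b where ab: "a \<in> set (hexagonals e k)" "b \<in> set (hexagonals e k)"
    "elem_sorted (n - c - 2 * a - b) (hexagonals e k)"
    using ter by (auto simp: ternary_ok_def list_all_iff exists_in_iff split: if_splits)
  obtain z where "z \<ge> 0" "c = z * (2 * z + e)" using hex[OF c(1)] by blast
  moreover obtain w where "w \<ge> 0" "a = w * (2 * w + e)" using hex[OF ab(1)] by blast
  moreover obtain x where "x \<ge> 0" "b = x * (2 * x + e)" using hex[OF ab(2)] by blast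
  moreover obtain y where "y \<ge> 0" "n - c - 2 * a - b = y * (2 * y + e)"
    using hex[OF elem_sortedD[OF ab(3)]] by blast
  moreover have "n = 2 * a + b + (n - c - 2 * a - b) + c" by simp
  ultimately show ?thesis by metis
qed

text \<open>Indices up to 5 are enough, because index 6 already gives 6 * 11 = 66 > 50.\<close>

lemma excluded_values:
  "list_all (\<lambda>w. list_all (\<lambda>x. list_all (\<lambda>y. list_all (\<lambda>z.
     if elem_sorted (2 * (w * (2 * w + -1)) + x * (2 * x + -1) + y * (2 * y + -1) + z * (2 * z + -1)) [11, 26, 50]
     then False else True) [0..5]) [0..5]) [0..5]) [0..5]"
  by code_simp

lemma hexagonal_nonneg: "0 \<le> x \<Longrightarrow> 0 \<le> x * (2 * x + -1)" for x :: int
  by (cases "x = 0") (auto intro: mult_nonneg_nonneg)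

lemma hexagonal_le_50:
  fixes x :: int
  assumes "0 \<le> x" "x * (2 * x + -1) \<le> 50"
  shows "x \<le> 5"
proof (rule ccontr)
  assume "\<not> x \<le> 5"
  then have "6 * 11 \<le> x * (2 * x + -1)" by (intro mult_mono) auto
  with assms show False by simp
qed

lemma not_excluded:
  fixes w x y z :: int
  assumes "0 \<le> w" "0 \<le> x" "0 \<le> y" "0 \<le> z"
  shows "2 * (w * (2 * w + -1)) + x * (2 * x + -1) + y * (2 * y + -1) + z * (2 * z + -1) \<notin> {11, 26, 50}"
    (is "?s \<notin> _")
proof
  assume s: "?s \<in> {11, 26, 50}"
  then have "?s \<le> 50" by auto
  then have "w \<le> 5" "x \<le> 5" "y \<le> 5" "z \<le> 5"
    using assms[THEN hexagonal_nonneg] by (intro hexagonal_le_50 assms; linarith)+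
  then have "\<not> elem_sorted ?s [11, 26, 50]"
  proof -
    have "w \<in> set [0..5]" "x \<in> set [0..5]" "y \<in> set [0..5]" "z \<in> set [0..5]"
      using assms \<open>w \<le> 5\<close> \<open>x \<le> 5\<close> \<open>y \<le> 5\<close> \<open>z \<le> 5\<close> by auto
    from excluded_values[unfolded list_all_iff, THEN bspec, OF this(1), THEN bspec, OF this(2),
        THEN bspec, OF this(3), THEN bspec, OF this(4)]
    show ?thesis by (auto split: if_splits)
  qed
  with s show False by auto
qed

lemma int_Nats_iff: "x \<in> \<nat> \<longleftrightarrow> 0 \<le> x" for x :: int
  by (metis Nats_cases of_nat_0_le_iff nonneg_int_cases of_nat_in_Nats)

theorem corollary8:
  shows "{2 * w * (2 * w - 1) + x * (2 * x - 1) + y * (2 * y - 1) + z * (2 * z - 1)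
            | w x y z :: int. w \<in> \<nat> \<and> x \<in> \<nat> \<and> y \<in> \<nat> \<and> z \<in> \<nat>}
          = \<nat> - {11, 26, 50}
         \<and>
         (\<forall>n::int. n \<ge> 90 \<longrightarrow>
          (\<exists>w\<in>\<nat>. \<exists>x\<in>\<nat>. \<exists>y\<in>\<nat>. \<exists>z\<in>\<nat>.
            n = 2 * w * (2 * w + 1) + x * (2 * x + 1) + y * (2 * y + 1) + z * (2 * z + 1)))"
proof (intro conjI equalityI subsetI allI impI)
  fix n :: int
  assume "n \<in> {2 * w * (2 * w - 1) + x * (2 * x - 1) + y * (2 * y - 1) + z * (2 * z - 1)
            | w x y z :: int. w \<in> \<nat> \<and> x \<in> \<nat> \<and> y \<in> \<nat> \<and> z \<in> \<nat>}"
  then obtain w x y z where nn: "0 \<le> w" "0 \<le> x" "0 \<le> y" "0 \<le> z"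
    and n: "n = 2 * (w * (2 * w + -1)) + x * (2 * x + -1) + y * (2 * y + -1) + z * (2 * z + -1)"
    by (auto simp: int_Nats_iff mult.assoc)
  have "n \<notin> {11, 26, 50}" unfolding n by (rule not_excluded[OF nn])
  moreover have "0 \<le> n" unfolding n using nn[THEN hexagonal_nonneg] by linarith
  ultimately show "n \<in> \<nat> - {11, 26, 50}" by (simp add: int_Nats_iff)
next
  fix n :: int
  assume n: "n \<in> \<nat> - {11, 26, 50}"
  have "\<exists>w\<ge>0. \<exists>x\<ge>0. \<exists>y\<ge>0. \<exists>z\<ge>0.
    n = 2 * (w * (2 * w + -1)) + x * (2 * x + -1) + y * (2 * y + -1) + z * (2 * z + -1)"
  proof (cases "n \<le> 1681")
    case True
    with n show ?thesis
      by (intro quaternary_okD[OF ternary_ok_minus quaternary_ok_minus]) (auto simp: int_Nats_iff)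
  qed (simp only: large_minus)
  then show "n \<in> {2 * w * (2 * w - 1) + x * (2 * x - 1) + y * (2 * y - 1) + z * (2 * z - 1)
            | w x y z :: int. w \<in> \<nat> \<and> x \<in> \<nat> \<and> y \<in> \<nat> \<and> z \<in> \<nat>}"
    by (simp add: int_Nats_iff mult.assoc) metis
next
  fix n :: int
  assume n: "n \<ge> 90"
  have "\<exists>w\<ge>0. \<exists>x\<ge>0. \<exists>y\<ge>0. \<exists>z\<ge>0.
    n = 2 * (w * (2 * w + 1)) + x * (2 * x + 1) + y * (2 * y + 1) + z * (2 * z + 1)"
  proof (cases "n \<le> 1921")
    case True
    with n show ?thesis
      by (intro quaternary_okD[OF ternary_ok_plus quaternary_ok_plus]) auto
  qed (simp only: large_plus)
  then show "\<exists>w\<in>\<nat>. \<exists>x\<in>\<nat>. \<exists>y\<in>\<nat>. \<exists>z\<in>\<nat>.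
      n = 2 * w * (2 * w + 1) + x * (2 * x + 1) + y * (2 * y + 1) + z * (2 * z + 1)"
    by (auto simp: int_Nats_iff mult.assoc Bex_def)
qed

end
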